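(* Let $\mathfrak m$ be a $\mathbb K$-module, let $k\ge 2$, and let $\mathcal F_k$ be the set of all complemented flags of length $k$ in $\mathfrak m$. (1) For every flag $\mathfrak f\in\mathcal F_k$, the group $U(\mathfrak f)$ acts simply transitively on the set $\mathfrak f^\top$ of flags of length $k$ in $\mathfrak m$ that are transversal to $\mathfrak f$. (2) Assume that $2,3,\ldots,k-1$ are invertible in $\mathbb K$. Then $(\mathcal X,\mathcal X')=(\mathcal F_k,\mathcal F_k)$, with the transversality relation of flags, is a linear pair geometry over $\mathbb K$, where for a transversal pair $(\mathfrak f,\mathfrak e)$ the $\mathbb K$-module structure on $(\mathfrak f^\top,\mathfrak e)$ (with zero vector $\mathfrak e$) is defined by declaring the bijection $$\mathfrak u(\mathfrak f)\to \mathfrak f^\top,\qquad X\mapsto \exp(X).\mathfrak e$$ to be a linear isomorphism. (3) The linear pair geometry defined in (2) is an affine pair geometry if $(\mathcal X,\mathcal X')$ is a Grassmann geometry, i.e. if $k=2$.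
   Context: $\mathbb K$ is a commutative ring with unit $1$ in which $2$ is invertible; "linear subspace" means $\mathbb K$-submodule. A flag of length $k$ in $\mathfrak m$ is a sequence $\mathfrak f=(\mathfrak f_1,\ldots,\mathfrak f_k)$ of linear subspaces with $0\subset\mathfrak f_1\subset\cdots\subset\mathfrak f_{k-1}\subset\mathfrak f_k=\mathfrak m$, all inclusions strict; put $\mathfrak f_0=0$. Two flags $\mathfrak f,\mathfrak f'$ of length $k$ are transversal, $\mathfrak f\top\mathfrak f'$, if $\mathfrak f_i\oplus\mathfrak f'_{k-i}=\mathfrak m$ for all $i=1,\ldots,k$. A flag is complemented if it admits a transversal flag. $U(\mathfrak f)=\{g\in \mathrm{GL}(\mathfrak m): (g-\mathrm{id})(\mathfrak f_i)\subset\mathfrak f_{i-1}\ \forall i=1,\ldots,k\}$ and $\mathfrak u(\mathfrak f)=\{X\in\mathrm{End}(\mathfrak m): X(\mathfrak f_i)\subset\mathfrak f_{i-1}\ \forall i=1,\ldots,k\}$. Elements $X\in\mathfrak u(\mathfrak f)$ satisfy $X^k=0$, and if $2,\ldots,k-1$ are invertible in $\mathbb K$, $\exp(X)=\sum_{i=0}^{k-1}X^i/i!$ defines a bijection $\mathfrak u(\mathfrak f)\to U(\mathfrak f)$. $\mathrm{GL}(\mathfrak m)$ acts on flags by $(g.\mathfrak e)_i=g(\mathfrak e_i)$. A pair geometry is a pair of sets $(\mathcal X,\mathcal X')$ with a relation $\top\subset\mathcal X\times\mathcal X'$ such that every $x\in\mathcal X$ is transversal to some $\alpha\in\mathcal X'$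 and every $\alpha\in\mathcal X'$ is transversal to some $x\in\mathcal X$. Write $\mathfrak v_\alpha=\alpha^\top=\{x\in\mathcal X: x\top\alpha\}$ and dually $\mathfrak v'_x=\{\alpha\in\mathcal X':x\top\alpha\}$. A linear pair geometry over $\mathbb K$ is a pair geometry in which, for every transversal pair $x\top\alpha$, both $\mathfrak v_\alpha$ and $\mathfrak v'_x$ are equipped with $\mathbb K$-module structures, with zero vectors $x$ and $\alpha$ respectively, denoted $(\mathfrak v_\alpha,x)$ and $(\mathfrak v'_x,\alpha)$. It is an affine pair geometry if for every $\alpha\in\mathcal X'$ the underlying affine structure of $(\mathfrak v_\alpha,x)$ does not depend on the choice of $x\in\mathfrak v_\alpha$, and dually. *)

theory Defs
  imports "HOL-Algebra.Group_Action" "HOL-Algebra.AbelCoset" "HOL-Algebra.Module"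
begin

section \<open>Modules\<close>

definition linear_maps ::
  "('r, 'x) ring_scheme \<Rightarrow> ('r, 'm, 'y) module_scheme \<Rightarrow> ('r, 'n, 'z) module_scheme \<Rightarrow> ('m \<Rightarrow> 'n) set"
  where "linear_maps R M N = {h \<in> carrier M \<rightarrow> carrier N.
    (\<forall>x\<in>carrier M. \<forall>y\<in>carrier M. h (x \<oplus>\<^bsub>M\<^esub> y) = h x \<oplus>\<^bsub>N\<^esub> h y) \<and>
    (\<forall>r\<in>carrier R. \<forall>x\<in>carrier M. h (r \<odot>\<^bsub>M\<^esub> x) = r \<odot>\<^bsub>N\<^esub> h x)}"

definition linear_isos ::
  "('r, 'x) ring_scheme \<Rightarrow> ('r, 'm, 'y) module_scheme \<Rightarrow> ('r, 'n, 'z) module_scheme \<Rightarrow> ('m \<Rightarrow> 'n) set"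
  where "linear_isos R M N = {h \<in> linear_maps R M N. bij_betw h (carrier M) (carrier N)}"

text \<open>As for \<^const>\<open>Bij\<close>, endomorphisms are taken to be extensional, so that each
  linear map is represented by exactly one function.\<close>

definition End_module ::
  "('r, 'x) ring_scheme \<Rightarrow> ('r, 'm, 'y) module_scheme \<Rightarrow> ('r, 'm \<Rightarrow> 'm) module"
  where "End_module R M =
    \<lparr>carrier = linear_maps R M M \<inter> extensional (carrier M),
     mult = compose (carrier M),
     one = (\<lambda>v\<in>carrier M. v),
     zero = (\<lambda>v\<in>carrier M. \<zero>\<^bsub>M\<^esub>),
     add = (\<lambda>X Y. (\<lambda>v\<in>carrier M. X v \<oplus>\<^bsub>M\<^esub> Y v)),
     smult = (\<lambda>r X. (\<lambda>v\<in>carrier M. r \<odot>\<^bsub>M\<^esub> X v))\<rparr>"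

definition GL :: "('r, 'x) ring_scheme \<Rightarrow> ('r, 'm, 'y) module_scheme \<Rightarrow> ('m \<Rightarrow> 'm) monoid"
  where "GL R M = (BijGroup (carrier M))\<lparr>carrier := linear_maps R M M \<inter> Bij (carrier M)\<rparr>"

text \<open>The structure on \<open>h ` carrier M\<close> that makes \<open>h\<close>, assumed injective on the carrier,
  a linear isomorphism. The multiplicative fields of the record play no role for modules.\<close>

definition transport ::
  "('m \<Rightarrow> 'n) \<Rightarrow> ('r, 'm, 'y) module_scheme \<Rightarrow> ('r, 'n) module"
  where "transport h M = (let h' = inv_into (carrier M) h in
    \<lparr>carrier = h ` carrier M,
     mult = (\<lambda>x y. h (h' x \<otimes>\<^bsub>M\<^esub> h' y)),
     one = h \<one>\<^bsub>M\<^esub>,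
     zero = h \<zero>\<^bsub>M\<^esub>,
     add = (\<lambda>x y. h (h' x \<oplus>\<^bsub>M\<^esub> h' y)),
     smult = (\<lambda>r x. h (r \<odot>\<^bsub>M\<^esub> h' x))\<rparr>)"

text \<open>The affine structure underlying a module consists of its carrier and the operations of
  forming affine combinations, i.e. linear combinations with coefficients of sum 1.\<close>

definition same_affine_structure ::
  "('r, 'x) ring_scheme \<Rightarrow> ('r, 'm, 'y) module_scheme \<Rightarrow> ('r, 'm, 'z) module_scheme \<Rightarrow> bool"
  where "same_affine_structure R M N \<longleftrightarrow> carrier M = carrier N \<and>
    (\<forall>(n::nat) c x. c \<in> {..<n} \<rightarrow> carrier R \<and> x \<in> {..<n} \<rightarrow> carrier M \<and>
        (\<Oplus>\<^bsub>R\<^esub>i\<in>{..<n}. c i) = \<one>\<^bsub>R\<^esub> \<longrightarrow>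
      (\<Oplus>\<^bsub>M\<^esub>i\<in>{..<n}. c i \<odot>\<^bsub>M\<^esub> x i) = (\<Oplus>\<^bsub>N\<^esub>i\<in>{..<n}. c i \<odot>\<^bsub>N\<^esub> x i))"


section \<open>Simply transitive actions\<close>

locale simply_transitive_action = transitive_action +
  assumes unique_element:
    "\<lbrakk> x \<in> E; g \<in> carrier G; h \<in> carrier G; \<phi> g x = \<phi> h x \<rbrakk> \<Longrightarrow> g = h"


section \<open>Pair geometries\<close>

locale pair_geometry =
  fixes X :: "'p set" and X' :: "'q set" and T :: "'p \<Rightarrow> 'q \<Rightarrow> bool"
  assumes ex_transversal_right: "x \<in> X \<Longrightarrow> \<exists>\<alpha>\<in>X'. T x \<alpha>"
    and ex_transversal_left: "\<alpha> \<in> X' \<Longrightarrow> \<exists>x\<in>X. T x \<alpha>"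

text \<open>\<open>V \<alpha> x\<close> and \<open>V' x \<alpha>\<close> are the modules \<open>(\<vv>\<^sub>\<alpha>, x)\<close> and \<open>(\<vv>'\<^sub>x, \<alpha>)\<close>.\<close>

locale linear_pair_geometry = cring R + pair_geometry X X' T
  for R :: "('r, 'x) ring_scheme" (structure)
    and X :: "'p set" and X' :: "'q set" and T :: "'p \<Rightarrow> 'q \<Rightarrow> bool" +
  fixes V :: "'q \<Rightarrow> 'p \<Rightarrow> ('r, 'p) module" and V' :: "'p \<Rightarrow> 'q \<Rightarrow> ('r, 'q) module"
  assumes V_module: "\<lbrakk> x \<in> X; \<alpha> \<in> X'; T x \<alpha> \<rbrakk> \<Longrightarrow> module R (V \<alpha> x)"
    and V_carrier: "\<lbrakk> x \<in> X; \<alpha> \<in> X'; T x \<alpha> \<rbrakk> \<Longrightarrow> carrier (V \<alpha> x) = {y \<in> X. T y \<alpha>}"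
    and V_zero: "\<lbrakk> x \<in> X; \<alpha> \<in> X'; T x \<alpha> \<rbrakk> \<Longrightarrow> \<zero>\<^bsub>V \<alpha> x\<^esub> = x"
    and V'_module: "\<lbrakk> x \<in> X; \<alpha> \<in> X'; T x \<alpha> \<rbrakk> \<Longrightarrow> module R (V' x \<alpha>)"
    and V'_carrier: "\<lbrakk> x \<in> X; \<alpha> \<in> X'; T x \<alpha> \<rbrakk> \<Longrightarrow> carrier (V' x \<alpha>) = {\<beta> \<in> X'. T x \<beta>}"
    and V'_zero: "\<lbrakk> x \<in> X; \<alpha> \<in> X'; T x \<alpha> \<rbrakk> \<Longrightarrow> \<zero>\<^bsub>V' x \<alpha>\<^esub> = \<alpha>"

locale affine_pair_geometry = linear_pair_geometry +
  assumes V_affine: "\<lbrakk> x \<in> X; y \<in> X; \<alpha> \<in> X'; T x \<alpha>; T y \<alpha> \<rbrakk>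
      \<Longrightarrow> same_affine_structure R (V \<alpha> x) (V \<alpha> y)"
    and V'_affine: "\<lbrakk> x \<in> X; \<alpha> \<in> X'; \<beta> \<in> X'; T x \<alpha>; T x \<beta> \<rbrakk>
      \<Longrightarrow> same_affine_structure R (V' x \<alpha>) (V' x \<beta>)"


section \<open>Flags\<close>

text \<open>A flag of length \<open>k\<close> is the list of its members with indices \<open>1, \<dots>, k\<close>;
  \<open>flag_nth\<close> prepends the member of index 0, which is the zero submodule.\<close>

definition flag_nth :: "('r, 'm, 'y) module_scheme \<Rightarrow> 'm set list \<Rightarrow> nat \<Rightarrow> 'm set"
  where "flag_nth M f i = ({\<zero>\<^bsub>M\<^esub>} # f) ! i"

definition flag ::
  "('r, 'x) ring_scheme \<Rightarrow> ('r, 'm, 'y) module_scheme \<Rightarrow> nat \<Rightarrow> 'm set list \<Rightarrow> bool"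
  where "flag R M k f \<longleftrightarrow> length f = k \<and>
    (\<forall>i\<in>{1..k}. submodule (flag_nth M f i) R M \<and> flag_nth M f (i - 1) \<subset> flag_nth M f i) \<and>
    flag_nth M f k = carrier M"

definition is_direct_sum :: "('r, 'm, 'y) module_scheme \<Rightarrow> 'm set \<Rightarrow> 'm set \<Rightarrow> bool"
  where "is_direct_sum M A B \<longleftrightarrow> A <+>\<^bsub>M\<^esub> B = carrier M \<and> A \<inter> B = {\<zero>\<^bsub>M\<^esub>}"

definition transversal ::
  "('r, 'm, 'y) module_scheme \<Rightarrow> nat \<Rightarrow> 'm set list \<Rightarrow> 'm set list \<Rightarrow> bool"
  where "transversal M k f e \<longleftrightarrow>
    (\<forall>i\<in>{1..k}. is_direct_sum M (flag_nth M f i) (flag_nth M e (k - i)))"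

definition transversal_flags ::
  "('r, 'x) ring_scheme \<Rightarrow> ('r, 'm, 'y) module_scheme \<Rightarrow> nat \<Rightarrow> 'm set list \<Rightarrow> 'm set list set"
  where "transversal_flags R M k f = {e. flag R M k e \<and> transversal M k f e}"

definition complemented_flags ::
  "('r, 'x) ring_scheme \<Rightarrow> ('r, 'm, 'y) module_scheme \<Rightarrow> nat \<Rightarrow> 'm set list set"
  where "complemented_flags R M k =
    {f. flag R M k f \<and> (\<exists>e. flag R M k e \<and> transversal M k f e)}"

definition act :: "('m \<Rightarrow> 'm) \<Rightarrow> 'm set list \<Rightarrow> 'm set list"
  where "act g e = map ((`) g) e"

definition U_grp ::
  "('r, 'x) ring_scheme \<Rightarrow> ('r, 'm, 'y) module_scheme \<Rightarrow> nat \<Rightarrow> 'm set list \<Rightarrow> ('m \<Rightarrow> 'm) set"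
  where "U_grp R M k f = {g \<in> carrier (GL R M).
    \<forall>i\<in>{1..k}. (\<lambda>v. g v \<ominus>\<^bsub>M\<^esub> v) ` flag_nth M f i \<subseteq> flag_nth M f (i - 1)}"

definition u_alg ::
  "('r, 'x) ring_scheme \<Rightarrow> ('r, 'm, 'y) module_scheme \<Rightarrow> nat \<Rightarrow> 'm set list \<Rightarrow> ('m \<Rightarrow> 'm) set"
  where "u_alg R M k f = {X \<in> carrier (End_module R M).
    \<forall>i\<in>{1..k}. X ` flag_nth M f i \<subseteq> flag_nth M f (i - 1)}"

abbreviation u_module ::
  "('r, 'x) ring_scheme \<Rightarrow> ('r, 'm, 'y) module_scheme \<Rightarrow> nat \<Rightarrow> 'm set list \<Rightarrow> ('r, 'm \<Rightarrow> 'm) module"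
  where "u_module R M k f \<equiv> (End_module R M)\<lparr>carrier := u_alg R M k f\<rparr>"

text \<open>The exponential, truncated after the term of degree \<open>k - 1\<close>; meaningful when
  \<open>X\<close> has vanishing \<open>k\<close>-th power and \<open>2, \<dots>, k - 1\<close> are invertible.\<close>

definition nil_exp ::
  "('r, 'x) ring_scheme \<Rightarrow> ('r, 'm, 'y) module_scheme \<Rightarrow> nat \<Rightarrow> ('m \<Rightarrow> 'm) \<Rightarrow> ('m \<Rightarrow> 'm)"
  where "nil_exp R M k X = (\<lambda>v\<in>carrier M.
    \<Oplus>\<^bsub>M\<^esub>i\<in>{..<k}. (inv\<^bsub>R\<^esub> ([(fact i :: nat)] \<cdot>\<^bsub>R\<^esub> \<one>\<^bsub>R\<^esub>)) \<odot>\<^bsub>M\<^esub> ((X ^^ i) v))"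

definition exp_act ::
  "('r, 'x) ring_scheme \<Rightarrow> ('r, 'm, 'y) module_scheme \<Rightarrow> nat \<Rightarrow> 'm set list \<Rightarrow> ('m \<Rightarrow> 'm) \<Rightarrow> 'm set list"
  where "exp_act R M k e X = act (nil_exp R M k X) e"

text \<open>The module \<open>(\<ff>\<^sup>\<top>, \<ee>)\<close> with zero vector \<open>\<ee>\<close>.\<close>

definition flag_module ::
  "('r, 'x) ring_scheme \<Rightarrow> ('r, 'm, 'y) module_scheme \<Rightarrow> nat \<Rightarrow> 'm set list \<Rightarrow> 'm set list
    \<Rightarrow> ('r, 'm set list) module"
  where "flag_module R M k f e = transport (exp_act R M k e) (u_module R M k f)"

end

(*
Let f be transversal to e. The projections onto f_i along e_(k-i) split the module into summands
isomorphic to the successive quotients of f, and an element of U(f) stabilising e acts trivially on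
every summand; this gives simple transitivity, a second transversal flag e' providing a second
splitting to which the first one is transported.

That exp maps u(f) bijectively onto U(f) is shown without the logarithm: in exp(X) = 1 + X + T(X),
if X and Y agree up to an endomorphism lowering the filtration by j, then T(X) and T(Y) agree up to
one lowering it by j + 1. So X + T(X) = g - 1 is a fixed point problem for a contraction and has
exactly one solution, reached after finitely many iterations.

For k = 2 one has exp(X) = 1 + X with products of elements of u(f) vanishing, so changing the base
point of the transversal flags from e to exp(Z).e is a translation by Z.
*)
theory Submission
  imports Defs
begin

section \<open>Linear maps\<close>

text \<open>Over a general ring there are no bases to work with; all splittings come from
  transversality. The summands never have to be handled as modules in their own right: differences
  of consecutive projections telescope to the identity, and each claim about a summand becomes one
  about such a difference. The contraction property rests on writing X^n - Y^n as a sum of products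
  with one factor X - Y and n - 1 factors X or Y. From n = 2 on, such a product lowers the
  filtration further than X - Y does. Neither commutation of X with Y nor any identity between the
  coefficients enters, whereas a logarithm would call for identities of formal power series. The
  last step is tied to length 2: in longer flags X and Z from u(f) need not commute, exp(X) exp(Z)
  is in general different from exp(X + Z), and a change of base point is no longer a translation in
  these coordinates.\<close>

lemma linear_mapsI:
  assumes "\<And>x. x \<in> carrier M \<Longrightarrow> h x \<in> carrier N"
    and "\<And>x y. \<lbrakk>x \<in> carrier M; y \<in> carrier M\<rbrakk> \<Longrightarrow> h (x \<oplus>\<^bsub>M\<^esub> y) = h x \<oplus>\<^bsub>N\<^esub> h y"
    and "\<And>r x. \<lbrakk>r \<in> carrier R; x \<in> carrier M\<rbrakk> \<Longrightarrow> h (r \<odot>\<^bsub>M\<^esub> x) = r \<odot>\<^bsub>N\<^esub> h x"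
  shows "h \<in> linear_maps R M N"
  using assms by (auto simp: linear_maps_def)

lemma linear_mapsD:
  assumes "h \<in> linear_maps R M N"
  shows "x \<in> carrier M \<Longrightarrow> h x \<in> carrier N"
    and "\<lbrakk>x \<in> carrier M; y \<in> carrier M\<rbrakk> \<Longrightarrow> h (x \<oplus>\<^bsub>M\<^esub> y) = h x \<oplus>\<^bsub>N\<^esub> h y"
    and "\<lbrakk>r \<in> carrier R; x \<in> carrier M\<rbrakk> \<Longrightarrow> h (r \<odot>\<^bsub>M\<^esub> x) = r \<odot>\<^bsub>N\<^esub> h x"
  using assms by (auto simp: linear_maps_def)

text \<open>Only values on the carrier matter for linearity. This mediates between plain lambda
  terms and the extensional members of \<open>End_module\<close> and \<open>GL\<close>.\<close>

lemma linear_maps_cong: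
  assumes "h \<in> linear_maps R M N" "module R M" "\<And>x. x \<in> carrier M \<Longrightarrow> h' x = h x"
  shows "h' \<in> linear_maps R M N"
proof -
  interpret module R M by fact
  show ?thesis
    using assms(3) by (intro linear_mapsI) (simp_all add: linear_mapsD[OF assms(1)])
qed

lemma linear_maps_comp:
  assumes "h \<in> linear_maps R M N" "g \<in> linear_maps R N P"
  shows "(\<lambda>x. g (h x)) \<in> linear_maps R M P"
  by (intro linear_mapsI) (simp_all add: linear_mapsD[OF assms(1)] linear_mapsD[OF assms(2)])

context module
begin

lemma linear_map_zero:
  assumes "module R N" "h \<in> linear_maps R M N"
  shows "h \<zero>\<^bsub>M\<^esub> = \<zero>\<^bsub>N\<^esub>"
proof -
  interpret N: module R N by fact
  have "h (\<zero> \<odot>\<^bsub>M\<^esub> \<zero>\<^bsub>M\<^esub>) = \<zero> \<odot>\<^bsub>N\<^esub> h \<zero>\<^bsub>M\<^esub>"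
    using assms(2) by (rule linear_mapsD(3)) auto
  then show ?thesis
    using linear_mapsD(1)[OF assms(2)] by simp
qed

lemma linear_map_uminus:
  assumes "module R N" "h \<in> linear_maps R M N" "x \<in> carrier M"
  shows "h (\<ominus>\<^bsub>M\<^esub> x) = \<ominus>\<^bsub>N\<^esub> h x"
proof -
  interpret N: module R N by fact
  have "h ((\<ominus> \<one>) \<odot>\<^bsub>M\<^esub> x) = (\<ominus> \<one>) \<odot>\<^bsub>N\<^esub> h x"
    using assms(2) by (rule linear_mapsD(3)) (use assms(3) in auto)
  then show ?thesis
    using assms(3) linear_mapsD(1)[OF assms(2,3)] by (simp add: smult_l_minus N.smult_l_minus)
qed

lemma linear_map_minus:
  assumes "module R N" "h \<in> linear_maps R M N" "x \<in> carrier M" "y \<in> carrier M"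
  shows "h (x \<ominus>\<^bsub>M\<^esub> y) = h x \<ominus>\<^bsub>N\<^esub> h y"
  using assms by (simp add: a_minus_def linear_mapsD(2)[OF assms(2)] linear_map_uminus[OF assms(1,2)])

lemma linear_map_finsum:
  assumes "module R N" "h \<in> linear_maps R M N" "finite A" "f \<in> A \<rightarrow> carrier M"
  shows "h (\<Oplus>\<^bsub>M\<^esub>i\<in>A. f i) = (\<Oplus>\<^bsub>N\<^esub>i\<in>A. h (f i))"
proof -
  interpret N: module R N by fact
  show ?thesis
    using assms(3,4)
  proof (induction A rule: finite_induct)
    case empty
    then show ?case using linear_map_zero[OF assms(1,2)] by simp
  next
    case (insert a A)
    moreover have "(\<lambda>i. h (f i)) \<in> A \<rightarrow> carrier N"
      using insert.prems linear_mapsD(1)[OF assms(2)] by auto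
    moreover have "f \<in> A \<rightarrow> carrier M" "f a \<in> carrier M"
      using insert.prems by auto
    ultimately show ?case
      by (simp add: linear_mapsD[OF assms(2)])
  qed
qed

section \<open>Differences and finite sums in a module\<close>

lemma minus_add_minus:
  assumes "a \<in> carrier M" "b \<in> carrier M" "c \<in> carrier M" "d \<in> carrier M"
  shows "(a \<oplus>\<^bsub>M\<^esub> b) \<ominus>\<^bsub>M\<^esub> (c \<oplus>\<^bsub>M\<^esub> d) = (a \<ominus>\<^bsub>M\<^esub> c) \<oplus>\<^bsub>M\<^esub> (b \<ominus>\<^bsub>M\<^esub> d)"
  using assms by (simp add: a_minus_def M.minus_add M.a_ac)

lemma minus_trans:
  assumes "a \<in> carrier M" "b \<in> carrier M" "c \<in> carrier M"
  shows "(a \<ominus>\<^bsub>M\<^esub> b) \<oplus>\<^bsub>M\<^esub> (b \<ominus>\<^bsub>M\<^esub> c) = a \<ominus>\<^bsub>M\<^esub> c"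
  using assms by (simp add: a_minus_def M.a_assoc M.r_neg1)

lemma uminus_minus:
  assumes "a \<in> carrier M" "b \<in> carrier M"
  shows "\<ominus>\<^bsub>M\<^esub> (a \<ominus>\<^bsub>M\<^esub> b) = b \<ominus>\<^bsub>M\<^esub> a"
  using assms by (simp add: a_minus_def M.minus_add M.a_comm)

lemma add_minus_cancel:
  assumes "a \<in> carrier M" "b \<in> carrier M"
  shows "b \<oplus>\<^bsub>M\<^esub> (a \<ominus>\<^bsub>M\<^esub> b) = a" "(a \<oplus>\<^bsub>M\<^esub> b) \<ominus>\<^bsub>M\<^esub> a = b" "(b \<ominus>\<^bsub>M\<^esub> a) \<ominus>\<^bsub>M\<^esub> b = \<ominus>\<^bsub>M\<^esub> a"
    "a \<ominus>\<^bsub>M\<^esub> (a \<ominus>\<^bsub>M\<^esub> b) = b" "(a \<ominus>\<^bsub>M\<^esub> b) \<oplus>\<^bsub>M\<^esub> b = a"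
proof -
  have *: "y \<oplus>\<^bsub>M\<^esub> (x \<oplus>\<^bsub>M\<^esub> \<ominus>\<^bsub>M\<^esub> y) = x" if "x \<in> carrier M" "y \<in> carrier M" for x y
    using that by (simp add: M.a_lcomm[of y] M.r_neg)
  show "b \<oplus>\<^bsub>M\<^esub> (a \<ominus>\<^bsub>M\<^esub> b) = a" "(a \<oplus>\<^bsub>M\<^esub> b) \<ominus>\<^bsub>M\<^esub> a = b" "(b \<ominus>\<^bsub>M\<^esub> a) \<ominus>\<^bsub>M\<^esub> b = \<ominus>\<^bsub>M\<^esub> a"
    "a \<ominus>\<^bsub>M\<^esub> (a \<ominus>\<^bsub>M\<^esub> b) = b" "(a \<ominus>\<^bsub>M\<^esub> b) \<oplus>\<^bsub>M\<^esub> b = a"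
    using assms *[of a b] *[of b a] *[of "\<ominus>\<^bsub>M\<^esub> a" b]
    by (simp_all add: a_minus_def M.minus_add M.a_assoc M.l_neg M.r_neg2)
qed

lemma minus_self [simp]: "a \<in> carrier M \<Longrightarrow> a \<ominus>\<^bsub>M\<^esub> a = \<zero>\<^bsub>M\<^esub>"
  by (simp add: a_minus_def M.r_neg)

lemma minus_eq_zero_iff:
  assumes "a \<in> carrier M" "b \<in> carrier M"
  shows "a \<ominus>\<^bsub>M\<^esub> b = \<zero>\<^bsub>M\<^esub> \<longleftrightarrow> a = b"
  using assms add_minus_cancel(5)[of a b] by auto

lemma minus_zero_right [simp]: "a \<in> carrier M \<Longrightarrow> a \<ominus>\<^bsub>M\<^esub> \<zero>\<^bsub>M\<^esub> = a"
  by (simp add: a_minus_def)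

lemma smult_minus_distr:
  assumes "r \<in> carrier R" "x \<in> carrier M" "y \<in> carrier M"
  shows "r \<odot>\<^bsub>M\<^esub> (x \<ominus>\<^bsub>M\<^esub> y) = r \<odot>\<^bsub>M\<^esub> x \<ominus>\<^bsub>M\<^esub> r \<odot>\<^bsub>M\<^esub> y"
  using assms by (simp add: a_minus_def smult_r_distr smult_r_minus)

lemma finsum_minus:
  assumes "finite A" "f \<in> A \<rightarrow> carrier M" "g \<in> A \<rightarrow> carrier M"
  shows "(\<Oplus>\<^bsub>M\<^esub>i\<in>A. f i \<ominus>\<^bsub>M\<^esub> g i) = (\<Oplus>\<^bsub>M\<^esub>i\<in>A. f i) \<ominus>\<^bsub>M\<^esub> (\<Oplus>\<^bsub>M\<^esub>i\<in>A. g i)"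
  using assms
proof (induction A rule: finite_induct)
  case (insert a A)
  moreover from insert.prems have "(\<lambda>i. f i \<ominus>\<^bsub>M\<^esub> g i) \<in> A \<rightarrow> carrier M"
    "f \<in> A \<rightarrow> carrier M" "g \<in> A \<rightarrow> carrier M" "f a \<in> carrier M" "g a \<in> carrier M"
    by auto
  ultimately show ?case by (simp add: minus_add_minus)
qed simp

text \<open>Serves \<open>finsum_part\<close>, where the summands are differences of consecutive
  projections.\<close>

lemma finsum_telescope:
  fixes p :: "nat \<Rightarrow> 'c"
  assumes "\<And>i. i \<le> n \<Longrightarrow> p i \<in> carrier M"
  shows "(\<Oplus>\<^bsub>M\<^esub>i\<in>{..<n}. p (Suc i) \<ominus>\<^bsub>M\<^esub> p i) = p n \<ominus>\<^bsub>M\<^esub> p 0"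
  using assms
proof (induction n)
  case (Suc n)
  have "(\<Oplus>\<^bsub>M\<^esub>i\<in>{..<Suc n}. p (Suc i) \<ominus>\<^bsub>M\<^esub> p i)
      = (p (Suc n) \<ominus>\<^bsub>M\<^esub> p n) \<oplus>\<^bsub>M\<^esub> (\<Oplus>\<^bsub>M\<^esub>i\<in>{..<n}. p (Suc i) \<ominus>\<^bsub>M\<^esub> p i)"
    using Suc.prems by (simp add: lessThan_Suc Pi_def)
  also have "\<dots> = p (Suc n) \<ominus>\<^bsub>M\<^esub> p 0"
    using Suc by (simp add: minus_trans)
  finally show ?case .
qed simp

section \<open>Operations on endomorphisms\<close>

lemma linear_maps_add:
  assumes "X \<in> linear_maps R M M" "Y \<in> linear_maps R M M"
  shows "(\<lambda>v. X v \<oplus>\<^bsub>M\<^esub> Y v) \<in> linear_maps R M M"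
  by (intro linear_mapsI)
    (simp_all add: linear_mapsD[OF assms(1)] linear_mapsD[OF assms(2)] smult_r_distr M.a_ac)

lemma linear_maps_smult:
  assumes "r \<in> carrier R" "X \<in> linear_maps R M M"
  shows "(\<lambda>v. r \<odot>\<^bsub>M\<^esub> X v) \<in> linear_maps R M M"
proof (rule linear_mapsI)
  fix s x assume "s \<in> carrier R" "x \<in> carrier M"
  \<comment> \<open>Commutativity of the scalars lets \<open>r\<close> and \<open>s\<close> change
    places.\<close>
  with assms(1) show "r \<odot>\<^bsub>M\<^esub> X (s \<odot>\<^bsub>M\<^esub> x) = s \<odot>\<^bsub>M\<^esub> (r \<odot>\<^bsub>M\<^esub> X x)"
    by (simp add: linear_mapsD[OF assms(2)] smult_assoc1[symmetric] R.m_comm)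
qed (simp_all add: assms(1) linear_mapsD[OF assms(2)] smult_r_distr)

lemma linear_maps_minus:
  assumes "X \<in> linear_maps R M M" "Y \<in> linear_maps R M M"
  shows "(\<lambda>v. X v \<ominus>\<^bsub>M\<^esub> Y v) \<in> linear_maps R M M"
  by (intro linear_mapsI)
    (simp_all add: linear_mapsD[OF assms(1)] linear_mapsD[OF assms(2)] minus_add_minus smult_minus_distr)

lemma linear_maps_zero: "(\<lambda>v. \<zero>\<^bsub>M\<^esub>) \<in> linear_maps R M M"
  by (intro linear_mapsI) auto

lemma linear_maps_id: "(\<lambda>v. v) \<in> linear_maps R M M"
  by (intro linear_mapsI) auto

lemma linear_maps_funpow:
  assumes "X \<in> linear_maps R M M"
  shows "X ^^ n \<in> linear_maps R M M"
proof (induction n)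
  case 0
  show ?case using linear_maps_id by (simp add: id_def)
next
  case (Suc n)
  then show ?case using linear_maps_comp[OF _ assms] by (simp add: comp_def)
qed

lemma linear_maps_finsum:
  assumes "finite A" "\<And>i. i \<in> A \<Longrightarrow> X i \<in> linear_maps R M M"
  shows "(\<lambda>v. \<Oplus>\<^bsub>M\<^esub>i\<in>A. X i v) \<in> linear_maps R M M"
proof (rule linear_mapsI)
  have *: "v \<in> carrier M \<Longrightarrow> (\<lambda>i. X i v) \<in> A \<rightarrow> carrier M" for v
    using linear_mapsD(1)[OF assms(2)] by simp
  show "(\<Oplus>\<^bsub>M\<^esub>i\<in>A. X i v) \<in> carrier M" if "v \<in> carrier M" for v
    using *[OF that] by simp
  show "(\<Oplus>\<^bsub>M\<^esub>i\<in>A. X i (v \<oplus>\<^bsub>M\<^esub> w)) = (\<Oplus>\<^bsub>M\<^esub>i\<in>A. X i v) \<oplus>\<^bsub>M\<^esub> (\<Oplus>\<^bsub>M\<^esub>i\<in>A. X i w)"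
    if "v \<in> carrier M" "w \<in> carrier M" for v w
  proof -
    have "(\<Oplus>\<^bsub>M\<^esub>i\<in>A. X i (v \<oplus>\<^bsub>M\<^esub> w)) = (\<Oplus>\<^bsub>M\<^esub>i\<in>A. X i v \<oplus>\<^bsub>M\<^esub> X i w)"
      using that *[OF that(1)] *[OF that(2)]
      by (intro M.finsum_cong') (auto simp: linear_mapsD(2)[OF assms(2)])
    also have "\<dots> = (\<Oplus>\<^bsub>M\<^esub>i\<in>A. X i v) \<oplus>\<^bsub>M\<^esub> (\<Oplus>\<^bsub>M\<^esub>i\<in>A. X i w)"
      using *[OF that(1)] *[OF that(2)] by (rule M.finsum_addf)
    finally show ?thesis .
  qed
  show "(\<Oplus>\<^bsub>M\<^esub>i\<in>A. X i (r \<odot>\<^bsub>M\<^esub> v)) = r \<odot>\<^bsub>M\<^esub> (\<Oplus>\<^bsub>M\<^esub>i\<in>A. X i v)"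
    if "r \<in> carrier R" "v \<in> carrier M" for r v
  proof -
    have "(\<Oplus>\<^bsub>M\<^esub>i\<in>A. X i (r \<odot>\<^bsub>M\<^esub> v)) = (\<Oplus>\<^bsub>M\<^esub>i\<in>A. r \<odot>\<^bsub>M\<^esub> X i v)"
      using that *[OF that(2)] by (intro M.finsum_cong') (auto simp: linear_mapsD(3)[OF assms(2)])
    also have "\<dots> = r \<odot>\<^bsub>M\<^esub> (\<Oplus>\<^bsub>M\<^esub>i\<in>A. X i v)"
      using finsum_smult_ldistr[OF assms(1) that(1) *[OF that(2)]] by simp
    finally show ?thesis .
  qed
qed

section \<open>Submodules and their images\<close>

lemma submodule_zero:
  assumes "submodule N R M"
  shows "\<zero>\<^bsub>M\<^esub> \<in> N"
  using submodule.axioms(1)[OF assms] subgroup.one_closed by fastforce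

lemma submodule_minus:
  assumes "submodule N R M" "x \<in> N" "y \<in> N"
  shows "x \<ominus>\<^bsub>M\<^esub> y \<in> N"
  using submoduleE[OF assms(1)] assms(2,3) by (simp add: a_minus_def)

lemma submodule_finsum:
  assumes "submodule N R M" "finite A" "\<And>i. i \<in> A \<Longrightarrow> f i \<in> N"
  shows "(\<Oplus>\<^bsub>M\<^esub>i\<in>A. f i) \<in> N"
  using assms(2,3)
proof (induction A rule: finite_induct)
  case empty
  then show ?case using submodule_zero[OF assms(1)] by simp
next
  case (insert a A)
  then have "f \<in> A \<rightarrow> carrier M" "f a \<in> carrier M"
    using submoduleE(1)[OF assms(1)] by auto
  then show ?case using insert submoduleE(5)[OF assms(1)] by simp
qed

lemma submodule_zero_set: "submodule {\<zero>\<^bsub>M\<^esub>} R M"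
  by (rule submoduleI) auto

lemma submodule_image:
  assumes "submodule N R M" "h \<in> linear_maps R M M"
  shows "submodule (h ` N) R M"
proof (rule submoduleI)
  note N = submoduleE[OF assms(1)] and h = linear_mapsD[OF assms(2)]
  show "h ` N \<subseteq> carrier M" using N(1) h(1) by auto
  show "\<zero>\<^bsub>M\<^esub> \<in> h ` N"
    using submodule_zero[OF assms(1)] linear_map_zero[OF module_axioms assms(2)] by force
  show "\<ominus>\<^bsub>M\<^esub> a \<in> h ` N" if "a \<in> h ` N" for a
  proof -
    from that obtain x where x: "x \<in> N" "a = h x" by auto
    then have "\<ominus>\<^bsub>M\<^esub> a = h (\<ominus>\<^bsub>M\<^esub> x)"
      using linear_map_uminus[OF module_axioms assms(2)] N(1) by auto
    with x N(3) show ?thesis by auto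
  qed
  show "a \<oplus>\<^bsub>M\<^esub> b \<in> h ` N" if "a \<in> h ` N" "b \<in> h ` N" for a b
  proof -
    from that obtain x y where x: "x \<in> N" "a = h x" "y \<in> N" "b = h y" by auto
    then have "a \<oplus>\<^bsub>M\<^esub> b = h (x \<oplus>\<^bsub>M\<^esub> y)" using h(2)[of x y] subsetD[OF N(1)] by simp
    with x N(5) show ?thesis by auto
  qed
  show "r \<odot>\<^bsub>M\<^esub> a \<in> h ` N" if "r \<in> carrier R" "a \<in> h ` N" for r a
  proof -
    from that obtain x where x: "x \<in> N" "a = h x" by auto
    then have "r \<odot>\<^bsub>M\<^esub> a = h (r \<odot>\<^bsub>M\<^esub> x)" using h(3)[of r x] subsetD[OF N(1)] that by simp
    with x N(4) that show ?thesis by auto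
  qed
qed

end

section \<open>Filtered modules\<close>

text \<open>A function of the index instead of a list, so that the zero member and the images under
  linear maps are treated like all other members. Inclusions are weak here; strictness enters with
  the flags.\<close>

locale filtered_module = module +
  fixes F :: "nat \<Rightarrow> 'c set" and k :: nat
  assumes F_0: "F 0 = {\<zero>\<^bsub>M\<^esub>}"
    and F_submodule: "i \<le> k \<Longrightarrow> submodule (F i) R M"
    and F_Suc: "i < k \<Longrightarrow> F i \<subseteq> F (Suc i)"
    and F_k: "F k = carrier M"
begin

lemma F_mono: "\<lbrakk>i \<le> j; j \<le> k\<rbrakk> \<Longrightarrow> F i \<subseteq> F j"
proof (induction j)
  case (Suc j)
  then show ?case using F_Suc[of j] by (cases "i = Suc j") auto
qed simp

lemma F_carrier: "\<lbrakk>i \<le> k; v \<in> F i\<rbrakk> \<Longrightarrow> v \<in> carrier M"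
  using F_mono[of i k] F_k by auto

lemma F_mem_mono: "\<lbrakk>v \<in> F i; i \<le> j; j \<le> k\<rbrakk> \<Longrightarrow> v \<in> F j"
  using F_mono by blast

lemmas F_minus = submodule_minus[OF F_submodule]
lemmas F_finsum = submodule_finsum[OF F_submodule]
lemmas F_zero = submodule_zero[OF F_submodule]
lemmas F_add = submoduleE(5)[OF F_submodule]
lemmas F_uminus = submoduleE(3)[OF F_submodule]
lemmas F_smult = submoduleE(4)[OF F_submodule]

text \<open>A graded version of membership in u(f), which is the case \<open>j = 1\<close>; the
  higher degrees measure how closely two endomorphisms agree. Subtraction truncates at 0, so a
  degree beyond \<open>i\<close> sends \<open>F i\<close> to zero.\<close>

definition lowers :: "nat \<Rightarrow> ('c \<Rightarrow> 'c) \<Rightarrow> bool"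
  where "lowers j X \<longleftrightarrow> (\<forall>i\<le>k. \<forall>v\<in>F i. X v \<in> F (i - j))"

lemma lowersD: "\<lbrakk>lowers j X; i \<le> k; v \<in> F i\<rbrakk> \<Longrightarrow> X v \<in> F (i - j)"
  by (simp add: lowers_def)

lemma lowers_mono: "\<lbrakk>lowers j X; l \<le> j\<rbrakk> \<Longrightarrow> lowers l X"
  unfolding lowers_def by (meson F_mem_mono diff_le_mono2 diff_le_self le_trans)

text \<open>The filtration has finite length, so agreement to a sufficient degree is equality. This
  is where the approximations of the contraction argument become exact.\<close>

lemma lowers_eq_zero: "\<lbrakk>lowers j X; k \<le> j; v \<in> carrier M\<rbrakk> \<Longrightarrow> X v = \<zero>\<^bsub>M\<^esub>"
  using lowersD[of j X k v] F_0 F_k by simp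

lemma lowers_cong: "\<lbrakk>lowers j X; \<And>v. v \<in> carrier M \<Longrightarrow> Y v = X v\<rbrakk> \<Longrightarrow> lowers j Y"
  by (simp add: lowers_def F_carrier)

lemma lowers_add: "\<lbrakk>lowers j X; lowers j Y\<rbrakk> \<Longrightarrow> lowers j (\<lambda>v. X v \<oplus>\<^bsub>M\<^esub> Y v)"
  by (simp add: lowers_def F_add)

lemma lowers_minus: "\<lbrakk>lowers j X; lowers j Y\<rbrakk> \<Longrightarrow> lowers j (\<lambda>v. X v \<ominus>\<^bsub>M\<^esub> Y v)"
  by (simp add: lowers_def F_minus)

lemma lowers_smult: "\<lbrakk>r \<in> carrier R; lowers j X\<rbrakk> \<Longrightarrow> lowers j (\<lambda>v. r \<odot>\<^bsub>M\<^esub> X v)"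
  by (simp add: lowers_def F_smult)

text \<open>Truncated subtraction still satisfies (a - b) - c = a - (b + c), so degrees add even
  when they run past the bottom of the filtration.\<close>

lemma lowers_comp: "\<lbrakk>lowers i X; lowers j Y\<rbrakk> \<Longrightarrow> lowers (i + j) (\<lambda>v. X (Y v))"
  unfolding lowers_def
  by (metis diff_diff_add add.commute diff_le_self le_trans)

lemma lowers_funpow: "lowers 1 X \<Longrightarrow> lowers n (X ^^ n)"
proof (induction n)
  case (Suc n)
  then show ?case using lowers_comp[of 1 X n "X ^^ n"] by (simp add: comp_def)
qed (simp add: lowers_def)

lemma lowers_finsum:
  assumes "finite A" "\<And>i. i \<in> A \<Longrightarrow> lowers j (X i)"
  shows "lowers j (\<lambda>v. \<Oplus>\<^bsub>M\<^esub>i\<in>A. X i v)"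
  unfolding lowers_def using assms by (auto intro!: F_finsum intro: lowersD)

lemma lowers_zero: "lowers j (\<lambda>v. \<zero>\<^bsub>M\<^esub>)"
  by (simp add: lowers_def F_zero)


subsection \<open>Unipotent maps\<close>

text \<open>For surjectivity on \<open>F (Suc i)\<close>, note that \<open>g v - v\<close> lies in
  \<open>F i\<close> and has a preimage \<open>x\<close> there by induction; then
  \<open>v - x\<close> is a preimage of \<open>v\<close>.\<close>

lemma unipotent_image:
  assumes g: "g \<in> linear_maps R M M" and u: "lowers 1 (\<lambda>v. g v \<ominus>\<^bsub>M\<^esub> v)"
  shows "i \<le> k \<Longrightarrow> g ` F i = F i"
proof (induction i)
  case 0
  then show ?case using F_0 linear_map_zero[OF module_axioms g] by simp
next
  case (Suc i)
  have diff: "g v \<ominus>\<^bsub>M\<^esub> v \<in> F i" if "v \<in> F (Suc i)" for v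
    using lowersD[OF u Suc.prems that] by simp
  have car: "v \<in> carrier M" "g v \<in> carrier M" if "v \<in> F (Suc i)" for v
    using F_carrier[OF Suc.prems that] linear_mapsD(1)[OF g] by auto
  have sub: "F i \<subseteq> F (Suc i)" using F_Suc Suc.prems by simp
  show ?case
  proof (intro equalityI subsetI)
    fix w assume "w \<in> g ` F (Suc i)"
    then obtain v where v: "v \<in> F (Suc i)" "w = g v" by auto
    then have "v \<oplus>\<^bsub>M\<^esub> (g v \<ominus>\<^bsub>M\<^esub> v) \<in> F (Suc i)"
      using F_add[OF Suc.prems] diff sub by blast
    then show "w \<in> F (Suc i)" using v car[OF v(1)] by (simp add: add_minus_cancel)
  next
    fix v assume v: "v \<in> F (Suc i)"
    have "g v \<ominus>\<^bsub>M\<^esub> v \<in> g ` F i" using diff[OF v] Suc by simp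
    then obtain x where x: "x \<in> F i" "g x = g v \<ominus>\<^bsub>M\<^esub> v" by auto
    then have "g (v \<ominus>\<^bsub>M\<^esub> x) = v"
      using car[OF v] car[of x] sub linear_map_minus[OF module_axioms g]
      by (auto simp: add_minus_cancel)
    moreover have "v \<ominus>\<^bsub>M\<^esub> x \<in> F (Suc i)" using F_minus[OF Suc.prems v] x sub by blast
    ultimately show "v \<in> g ` F (Suc i)" by force
  qed
qed

lemma unipotent_mem:
  assumes "g \<in> linear_maps R M M" "lowers 1 (\<lambda>v. g v \<ominus>\<^bsub>M\<^esub> v)" "i \<le> k" "v \<in> F i"
  shows "g v \<in> F i"
  using unipotent_image[OF assms(1-3)] assms(4) by auto

text \<open>A vector \<open>v\<close> killed by \<open>g\<close> equals -(g v - v), so it drops one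
  step of the filtration again and again until it reaches \<open>F 0\<close>. Thanks to this, maps
  constructed as unipotent are automatically elements of GL.\<close>

lemma unipotent_bij:
  assumes g: "g \<in> linear_maps R M M" and u: "lowers 1 (\<lambda>v. g v \<ominus>\<^bsub>M\<^esub> v)"
  shows "bij_betw g (carrier M) (carrier M)"
proof -
  have zero: "v \<in> F (k - j)" if "v \<in> carrier M" "g v = \<zero>\<^bsub>M\<^esub>" for v j
  proof (induction j)
    case 0
    then show ?case using that F_k by simp
  next
    case (Suc j)
    have "\<zero>\<^bsub>M\<^esub> \<ominus>\<^bsub>M\<^esub> v \<in> F (k - j - 1)" using lowersD[OF u _ Suc] that by simp
    then have "\<ominus>\<^bsub>M\<^esub> (\<zero>\<^bsub>M\<^esub> \<ominus>\<^bsub>M\<^esub> v) \<in> F (k - Suc j)" using F_uminus[of "k - Suc j"] by simp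
    then show ?case using that by (simp add: uminus_minus)
  qed
  have "inj_on g (carrier M)"
  proof (rule inj_onI)
    fix v w assume vw: "v \<in> carrier M" "w \<in> carrier M" "g v = g w"
    then have "g (v \<ominus>\<^bsub>M\<^esub> w) = \<zero>\<^bsub>M\<^esub>"
      using linear_mapsD(1)[OF g] by (simp add: linear_map_minus[OF module_axioms g])
    then have "v \<ominus>\<^bsub>M\<^esub> w = \<zero>\<^bsub>M\<^esub>" using zero[of "v \<ominus>\<^bsub>M\<^esub> w" k] vw F_0 by simp
    then show "v = w" using vw by (simp add: minus_eq_zero_iff)
  qed
  then show ?thesis
    using unipotent_image[OF g u, of k] F_k by (simp add: bij_betw_def)
qed


subsection \<open>Truncated power series of lowering maps\<close>

text \<open>The terms T(X) of degree at least 2 in a power series 1 + X + T(X). The coefficients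
  stay arbitrary, since the contraction argument depends only on the starting degree 2.\<close>

definition tail :: "(nat \<Rightarrow> 'a) \<Rightarrow> ('c \<Rightarrow> 'c) \<Rightarrow> 'c \<Rightarrow> 'c"
  where "tail c X v = (\<Oplus>\<^bsub>M\<^esub>n\<in>{2..<k}. c n \<odot>\<^bsub>M\<^esub> (X ^^ n) v)"

lemma linear_maps_tail:
  assumes "\<And>n. n < k \<Longrightarrow> c n \<in> carrier R" "X \<in> linear_maps R M M"
  shows "tail c X \<in> linear_maps R M M"
  unfolding tail_def using assms
  by (intro linear_maps_finsum linear_maps_smult linear_maps_funpow) auto

lemma lowers_tail:
  assumes "\<And>n. n < k \<Longrightarrow> c n \<in> carrier R" "lowers 1 X"
  shows "lowers 1 (tail c X)"
  unfolding tail_def using assms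
  by (intro lowers_finsum lowers_smult) (auto intro: lowers_mono[OF lowers_funpow])

text \<open>Induction along X^(n+2) - Y^(n+2) = X (X^(n+1) - Y^(n+1)) + (X - Y) Y^(n+1), which does
  not require X and Y to commute. Of the \<open>Suc n\<close> factors of a product, the difference
  contributes degree \<open>j\<close> and each of the other \<open>n\<close> contributes 1.\<close>

lemma lowers_funpow_minus:
  assumes X: "X \<in> linear_maps R M M" "lowers 1 X" and Y: "Y \<in> linear_maps R M M" "lowers 1 Y"
    and XY: "lowers j (\<lambda>v. X v \<ominus>\<^bsub>M\<^esub> Y v)"
  shows "lowers (n + j) (\<lambda>v. (X ^^ Suc n) v \<ominus>\<^bsub>M\<^esub> (Y ^^ Suc n) v)"
proof (induction n)
  case 0
  then show ?case using XY by simp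
next
  case (Suc n)
  have a: "lowers (Suc n + j) (\<lambda>v. X ((X ^^ Suc n) v \<ominus>\<^bsub>M\<^esub> (Y ^^ Suc n) v))"
    using lowers_comp[OF X(2) Suc] by simp
  have b: "lowers (Suc n + j) (\<lambda>v. X ((Y ^^ Suc n) v) \<ominus>\<^bsub>M\<^esub> Y ((Y ^^ Suc n) v))"
    using lowers_comp[OF XY lowers_funpow[OF Y(2), of "Suc n"]] by (simp add: add.commute)
  show ?case
  proof (rule lowers_cong[OF lowers_add[OF a b]])
    fix v assume "v \<in> carrier M"
    then have "(X ^^ Suc n) v \<in> carrier M" "(Y ^^ Suc n) v \<in> carrier M"
      using linear_mapsD(1)[OF linear_maps_funpow] X Y by blast+
    then show "(X ^^ Suc (Suc n)) v \<ominus>\<^bsub>M\<^esub> (Y ^^ Suc (Suc n)) v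
      = X ((X ^^ Suc n) v \<ominus>\<^bsub>M\<^esub> (Y ^^ Suc n) v)
        \<oplus>\<^bsub>M\<^esub> (X ((Y ^^ Suc n) v) \<ominus>\<^bsub>M\<^esub> Y ((Y ^^ Suc n) v))"
      by (simp add: linear_map_minus[OF module_axioms X(1)] minus_trans
          linear_mapsD(1)[OF X(1)] linear_mapsD(1)[OF Y(1)])
  qed
qed

text \<open>The contraction property behind the bijectivity of the exponential: \<open>tail c\<close> gains one
  degree in the filtration.\<close>

lemma lowers_tail_minus:
  assumes c: "\<And>n. n < k \<Longrightarrow> c n \<in> carrier R"
    and X: "X \<in> linear_maps R M M" "lowers 1 X" and Y: "Y \<in> linear_maps R M M" "lowers 1 Y"
    and XY: "lowers j (\<lambda>v. X v \<ominus>\<^bsub>M\<^esub> Y v)"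
  shows "lowers (Suc j) (\<lambda>v. tail c X v \<ominus>\<^bsub>M\<^esub> tail c Y v)"
proof (rule lowers_cong)
  show "lowers (Suc j) (\<lambda>v. \<Oplus>\<^bsub>M\<^esub>n\<in>{2..<k}. c n \<odot>\<^bsub>M\<^esub> ((X ^^ n) v \<ominus>\<^bsub>M\<^esub> (Y ^^ n) v))"
  proof (intro lowers_finsum lowers_smult)
    fix n assume n: "n \<in> {2..<k}"
    then show "c n \<in> carrier R" using c by simp
    \<comment> \<open>\<open>m\<close> counts the factors beside the difference;
      \<open>1 \<le> m\<close> supplies the additional degree.\<close>
    obtain m where m: "n = Suc m" "1 \<le> m" using n by (cases n) auto
    show "lowers (Suc j) (\<lambda>v. (X ^^ n) v \<ominus>\<^bsub>M\<^esub> (Y ^^ n) v)"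
      unfolding m(1) by (rule lowers_mono[OF lowers_funpow_minus[OF X Y XY]]) (use m in simp)
  qed simp
  fix v assume v: "v \<in> carrier M"
  have car: "(X ^^ n) v \<in> carrier M" "(Y ^^ n) v \<in> carrier M" for n
    using linear_mapsD(1)[OF linear_maps_funpow v] X Y by blast+
  have "(\<Oplus>\<^bsub>M\<^esub>n\<in>{2..<k}. c n \<odot>\<^bsub>M\<^esub> ((X ^^ n) v \<ominus>\<^bsub>M\<^esub> (Y ^^ n) v))
      = (\<Oplus>\<^bsub>M\<^esub>n\<in>{2..<k}. c n \<odot>\<^bsub>M\<^esub> (X ^^ n) v \<ominus>\<^bsub>M\<^esub> c n \<odot>\<^bsub>M\<^esub> (Y ^^ n) v)"
    using c car by (intro M.finsum_cong') (auto simp: smult_minus_distr)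
  also have "\<dots> = tail c X v \<ominus>\<^bsub>M\<^esub> tail c Y v"
    unfolding tail_def using c car by (intro finsum_minus) auto
  finally show "tail c X v \<ominus>\<^bsub>M\<^esub> tail c Y v
    = (\<Oplus>\<^bsub>M\<^esub>n\<in>{2..<k}. c n \<odot>\<^bsub>M\<^esub> ((X ^^ n) v \<ominus>\<^bsub>M\<^esub> (Y ^^ n) v))" by simp
qed

text \<open>The equation says X - Y = T(Y) - T(X). By the contraction property a difference of
  degree j is thus also of degree j + 1, for every j, and so it vanishes.\<close>

lemma tail_equation_unique:
  assumes c: "\<And>n. n < k \<Longrightarrow> c n \<in> carrier R"
    and X: "X \<in> linear_maps R M M" "lowers 1 X" and Y: "Y \<in> linear_maps R M M" "lowers 1 Y"
    and eq: "\<And>v. v \<in> carrier M \<Longrightarrow> X v \<oplus>\<^bsub>M\<^esub> tail c X v = Y v \<oplus>\<^bsub>M\<^esub> tail c Y v"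
    and v: "v \<in> carrier M"
  shows "X v = Y v"
proof -
  note car = linear_mapsD(1)[OF X(1)] linear_mapsD(1)[OF Y(1)]
    linear_mapsD(1)[OF linear_maps_tail[OF c X(1)]] linear_mapsD(1)[OF linear_maps_tail[OF c Y(1)]]
  have diff: "X v \<ominus>\<^bsub>M\<^esub> Y v = tail c Y v \<ominus>\<^bsub>M\<^esub> tail c X v" if "v \<in> carrier M" for v
  proof -
    have "(X v \<oplus>\<^bsub>M\<^esub> tail c X v) \<ominus>\<^bsub>M\<^esub> (Y v \<oplus>\<^bsub>M\<^esub> tail c Y v) = \<zero>\<^bsub>M\<^esub>"
      using eq[OF that] car that by simp
    then have "(X v \<ominus>\<^bsub>M\<^esub> Y v) \<ominus>\<^bsub>M\<^esub> (tail c Y v \<ominus>\<^bsub>M\<^esub> tail c X v) = \<zero>\<^bsub>M\<^esub>"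
      using car that by (simp add: minus_add_minus a_minus_def[of _ "_ \<ominus>\<^bsub>M\<^esub> _"] uminus_minus)
    then show ?thesis using car that by (simp add: minus_eq_zero_iff)
  qed
  have lowers_diff: "lowers (Suc j) (\<lambda>v. X v \<ominus>\<^bsub>M\<^esub> Y v)" for j
  proof (induction j)
    case 0
    show ?case using lowers_minus[OF X(2) Y(2)] by simp
  next
    case (Suc j)
    \<comment> \<open>\<open>X\<close> and \<open>Y\<close> change places in \<open>diff\<close>, so
      the induction hypothesis is used with the opposite sign, as zero minus the known
      difference.\<close>
    have *: "lowers (Suc j) (\<lambda>v. Y v \<ominus>\<^bsub>M\<^esub> X v)"
      by (rule lowers_cong[OF lowers_minus[OF lowers_zero Suc]])
        (use car in \<open>simp add: a_minus_def[of M "\<zero>\<^bsub>M\<^esub>"] uminus_minus\<close>)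
    have "lowers (Suc (Suc j)) (\<lambda>v. tail c Y v \<ominus>\<^bsub>M\<^esub> tail c X v)"
      by (rule lowers_tail_minus[OF c Y X *])
    then show ?case by (rule lowers_cong) (rule diff)
  qed
  have "X v \<ominus>\<^bsub>M\<^esub> Y v = \<zero>\<^bsub>M\<^esub>" by (rule lowers_eq_zero[OF lowers_diff[of k] _ v]) simp
  then show ?thesis using car v by (simp add: minus_eq_zero_iff)
qed

text \<open>Solutions are the fixed points of Y |-> N - T(Y). Iteration starts at \<open>N\<close>,
  and the contraction makes consecutive iterates agree to ever higher degree.\<close>

lemma tail_equation_solvable:
  assumes c: "\<And>n. n < k \<Longrightarrow> c n \<in> carrier R"
    and N: "N \<in> linear_maps R M M" "lowers 1 N"
  obtains X where "X \<in> linear_maps R M M" "lowers 1 X"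
    "\<And>v. v \<in> carrier M \<Longrightarrow> X v \<oplus>\<^bsub>M\<^esub> tail c X v = N v"
proof -
  define X where "X j = ((\<lambda>Y v. N v \<ominus>\<^bsub>M\<^esub> tail c Y v) ^^ j) N" for j
  have X_0: "X 0 = N" and X_Suc: "X (Suc j) = (\<lambda>v. N v \<ominus>\<^bsub>M\<^esub> tail c (X j) v)" for j
    by (simp_all add: X_def)
  have X: "X j \<in> linear_maps R M M" "lowers 1 (X j)" for j
  proof (induction j)
    case 0
    { case 1 show ?case using N by (simp add: X_0) }
    { case 2 show ?case using N by (simp add: X_0) }
  next
    case (Suc j)
    { case 1 show ?case
        unfolding X_Suc by (intro linear_maps_minus N(1) linear_maps_tail c Suc(1)) }
    { case 2 show ?case
        unfolding X_Suc by (intro lowers_minus N(2) lowers_tail c Suc(2)) }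
  qed
  note car = linear_mapsD(1)[OF N(1)] linear_mapsD(1)[OF X(1)]
    linear_mapsD(1)[OF linear_maps_tail[OF c X(1)]]
  have step: "lowers (Suc j) (\<lambda>v. X j v \<ominus>\<^bsub>M\<^esub> X (Suc j) v)" for j
  proof (induction j)
    case 0
    show ?case using lowers_minus[OF X(2) X(2)] by simp
  next
    case (Suc j)
    have "lowers (Suc (Suc j)) (\<lambda>v. tail c (X (Suc j)) v \<ominus>\<^bsub>M\<^esub> tail c (X j) v)"
    proof (rule lowers_tail_minus[OF c X X])
      show "lowers (Suc j) (\<lambda>v. X (Suc j) v \<ominus>\<^bsub>M\<^esub> X j v)"
        by (rule lowers_cong[OF lowers_minus[OF lowers_zero Suc]])
          (use car in \<open>simp add: a_minus_def[of M "\<zero>\<^bsub>M\<^esub>"] uminus_minus\<close>)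
    qed
    then show ?case
    proof (rule lowers_cong)
      fix v assume v: "v \<in> carrier M"
      have "X (Suc j) v \<ominus>\<^bsub>M\<^esub> X (Suc (Suc j)) v
          = (N v \<oplus>\<^bsub>M\<^esub> \<ominus>\<^bsub>M\<^esub> tail c (X j) v) \<ominus>\<^bsub>M\<^esub> (N v \<oplus>\<^bsub>M\<^esub> \<ominus>\<^bsub>M\<^esub> tail c (X (Suc j)) v)"
        using X_Suc[of j] X_Suc[of "Suc j"] by (simp add: a_minus_def)
      also have "\<dots> = \<ominus>\<^bsub>M\<^esub> tail c (X j) v \<ominus>\<^bsub>M\<^esub> \<ominus>\<^bsub>M\<^esub> tail c (X (Suc j)) v"
        using car v by (simp add: minus_add_minus)
      also have "\<dots> = tail c (X (Suc j)) v \<ominus>\<^bsub>M\<^esub> tail c (X j) v"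
        using car v by (simp add: a_minus_def M.a_comm)
      finally show "X (Suc j) v \<ominus>\<^bsub>M\<^esub> X (Suc (Suc j)) v
        = tail c (X (Suc j)) v \<ominus>\<^bsub>M\<^esub> tail c (X j) v" .
    qed
  qed
  have "X k v \<oplus>\<^bsub>M\<^esub> tail c (X k) v = N v" if v: "v \<in> carrier M" for v
  proof -
    \<comment> \<open>Degree \<open>Suc k\<close> exceeds the length of the filtration, so these two
      iterates coincide on the carrier.\<close>
    have "X k v \<ominus>\<^bsub>M\<^esub> X (Suc k) v = \<zero>\<^bsub>M\<^esub>"
      by (rule lowers_eq_zero[OF step _ v]) simp
    then have "X k v = X (Suc k) v" using car v by (simp add: minus_eq_zero_iff)
    then have "X k v = N v \<ominus>\<^bsub>M\<^esub> tail c (X k) v" by (simp add: X_Suc)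
    then show ?thesis using car v by (simp add: add_minus_cancel)
  qed
  with X show ?thesis by (intro that[of "X k"]) auto
qed

end

section \<open>Transversal filtrations\<close>

context module
begin

section \<open>Direct sums and projections along a complement\<close>

lemma is_direct_sum_sym:
  assumes "submodule A R M" "submodule B R M" "is_direct_sum M A B"
  shows "is_direct_sum M B A"
proof -
  have "A \<subseteq> carrier M" "B \<subseteq> carrier M" using submoduleE(1) assms(1,2) by auto
  then have "A <+>\<^bsub>M\<^esub> B = B <+>\<^bsub>M\<^esub> A"
    unfolding set_add_def' using M.a_comm by blast
  with assms(3) show ?thesis by (auto simp: is_direct_sum_def)
qed

lemma is_direct_sum_image:
  assumes "submodule A R M" "submodule B R M" "is_direct_sum M A B"
    and g: "g \<in> linear_maps R M M" "bij_betw g (carrier M) (carrier M)"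
  shows "is_direct_sum M (g ` A) (g ` B)"
proof -
  have car: "A \<subseteq> carrier M" "B \<subseteq> carrier M" using submoduleE(1) assms(1,2) by auto
  have "g ` A <+>\<^bsub>M\<^esub> g ` B = (\<Union>a\<in>A. \<Union>b\<in>B. {g a \<oplus>\<^bsub>M\<^esub> g b})"
    by (simp add: set_add_def')
  also have "\<dots> = (\<Union>a\<in>A. \<Union>b\<in>B. {g (a \<oplus>\<^bsub>M\<^esub> b)})"
    using car linear_mapsD(2)[OF g(1)] by (intro SUP_cong refl) (auto simp: subset_iff)
  also have "\<dots> = g ` (A <+>\<^bsub>M\<^esub> B)"
    by (auto simp: set_add_def')
  also have "\<dots> = carrier M"
    using assms(3) g(2) by (simp add: is_direct_sum_def bij_betw_def)
  finally have "g ` A <+>\<^bsub>M\<^esub> g ` B = carrier M" .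
  moreover have "g ` A \<inter> g ` B = g ` (A \<inter> B)"
    using g(2) car by (intro inj_on_image_Int[symmetric]) (auto simp: bij_betw_def)
  ultimately show ?thesis
    using assms(3) linear_map_zero[OF module_axioms g(1)] by (simp add: is_direct_sum_def)
qed

text \<open>The projection onto \<open>A\<close> along \<open>B\<close>, given by the two
  memberships that characterise its value; linearity and special values then follow by checking
  these memberships through \<open>complement_proj_eq\<close>.\<close>

definition complement_proj :: "'c set \<Rightarrow> 'c set \<Rightarrow> 'c \<Rightarrow> 'c"
  where "complement_proj A B v = (THE a. a \<in> A \<and> v \<ominus>\<^bsub>M\<^esub> a \<in> B)"

context
  fixes A B
  assumes A: "submodule A R M" and B: "submodule B R M" and AB: "is_direct_sum M A B"
begin

text \<open>Two candidates for the value differ by an element of both \<open>A\<close> and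
  \<open>B\<close>, hence by zero.\<close>

lemma complement_proj_eq:
  assumes "v \<in> carrier M" "a \<in> A" "v \<ominus>\<^bsub>M\<^esub> a \<in> B"
  shows "complement_proj A B v = a"
  unfolding complement_proj_def
proof (rule the_equality)
  fix b assume b: "b \<in> A \<and> v \<ominus>\<^bsub>M\<^esub> b \<in> B"
  have car: "a \<in> carrier M" "b \<in> carrier M" using submoduleE(1)[OF A] assms b by auto
  have "(b \<ominus>\<^bsub>M\<^esub> v) \<oplus>\<^bsub>M\<^esub> (v \<ominus>\<^bsub>M\<^esub> a) \<in> B"
    using submoduleE(5)[OF B _ assms(3)] submoduleE(3)[OF B, of "v \<ominus>\<^bsub>M\<^esub> b"] b car assms
    by (simp add: uminus_minus)
  then have "b \<ominus>\<^bsub>M\<^esub> a \<in> A \<inter> B"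
    using submodule_minus[OF A] b assms car by (simp add: minus_trans)
  then have "b \<ominus>\<^bsub>M\<^esub> a = \<zero>\<^bsub>M\<^esub>" using AB by (auto simp: is_direct_sum_def)
  then show "b = a" using car by (simp add: minus_eq_zero_iff)
qed (use assms in simp)

lemma complement_proj_mem:
  assumes "v \<in> carrier M"
  shows "complement_proj A B v \<in> A" "v \<ominus>\<^bsub>M\<^esub> complement_proj A B v \<in> B"
proof -
  obtain a b where ab: "a \<in> A" "b \<in> B" "v = a \<oplus>\<^bsub>M\<^esub> b"
    using assms AB unfolding is_direct_sum_def set_add_def' by blast
  then have "v \<ominus>\<^bsub>M\<^esub> a = b"
    using subsetD[OF submoduleE(1)[OF A]] subsetD[OF submoduleE(1)[OF B]]
    by (simp add: add_minus_cancel)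
  then have "complement_proj A B v = a" using complement_proj_eq assms ab by blast
  then show "complement_proj A B v \<in> A" "v \<ominus>\<^bsub>M\<^esub> complement_proj A B v \<in> B"
    using ab \<open>v \<ominus>\<^bsub>M\<^esub> a = b\<close> by auto
qed

lemma linear_maps_complement_proj: "complement_proj A B \<in> linear_maps R M M"
proof (rule linear_mapsI)
  let ?p = "complement_proj A B"
  show car: "?p x \<in> carrier M" if "x \<in> carrier M" for x
    using complement_proj_mem(1)[OF that] submoduleE(1)[OF A] by auto
  show "?p (x \<oplus>\<^bsub>M\<^esub> y) = ?p x \<oplus>\<^bsub>M\<^esub> ?p y" if "x \<in> carrier M" "y \<in> carrier M" for x y
    using that complement_proj_mem submoduleE(5)[OF A] submoduleE(5)[OF B] car
    by (intro complement_proj_eq) (simp_all add: minus_add_minus)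
  show "?p (r \<odot>\<^bsub>M\<^esub> x) = r \<odot>\<^bsub>M\<^esub> ?p x" if "r \<in> carrier R" "x \<in> carrier M" for r x
    using that complement_proj_mem submoduleE(4)[OF A] submoduleE(4)[OF B] car
    by (intro complement_proj_eq) (simp_all add: smult_minus_distr[symmetric])
qed

lemma complement_proj_left: "v \<in> A \<Longrightarrow> complement_proj A B v = v"
  using submoduleE(1)[OF A] submodule_zero[OF B] by (intro complement_proj_eq) auto

lemma complement_proj_right: "v \<in> B \<Longrightarrow> complement_proj A B v = \<zero>\<^bsub>M\<^esub>"
  using submoduleE(1)[OF B] submodule_zero[OF A] by (intro complement_proj_eq) auto

end

end

text \<open>The index 0 is included so that the projections form a chain from \<open>proj 0\<close>,
  which is zero, to \<open>proj k\<close>, which is the identity on the carrier.\<close>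

locale transversal_filtrations = filtered_module +
  fixes E :: "nat \<Rightarrow> 'c set"
  assumes E_filtered: "filtered_module R M E k"
    and direct: "i \<le> k \<Longrightarrow> is_direct_sum M (F i) (E (k - i))"
begin

sublocale E: filtered_module R M E k
  by (rule E_filtered)

definition proj :: "nat \<Rightarrow> 'c \<Rightarrow> 'c"
  where "proj i = complement_proj (F i) (E (k - i))"

lemma E_complement: "submodule (E (k - i)) R M"
  by (rule E.F_submodule) simp

lemma
  assumes "i \<le> k"
  shows linear_maps_proj: "proj i \<in> linear_maps R M M"
    and proj_mem: "v \<in> carrier M \<Longrightarrow> proj i v \<in> F i"
    and minus_proj_mem: "v \<in> carrier M \<Longrightarrow> v \<ominus>\<^bsub>M\<^esub> proj i v \<in> E (k - i)"
    and proj_left: "v \<in> F i \<Longrightarrow> proj i v = v"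
    and proj_right: "v \<in> E (k - i) \<Longrightarrow> proj i v = \<zero>\<^bsub>M\<^esub>"
  unfolding proj_def
  using linear_maps_complement_proj[OF F_submodule[OF assms] E_complement direct[OF assms]]
    complement_proj_mem[OF F_submodule[OF assms] E_complement direct[OF assms]]
    complement_proj_left[OF F_submodule[OF assms] E_complement direct[OF assms]]
    complement_proj_right[OF F_submodule[OF assms] E_complement direct[OF assms]]
  by auto

text \<open>\<open>part i\<close> is the projection onto the summand \<open>F (i + 1) \<inter> E (k - i)\<close> of \<open>M\<close>.\<close>

definition part :: "nat \<Rightarrow> 'c \<Rightarrow> 'c"
  where "part i v = proj (Suc i) v \<ominus>\<^bsub>M\<^esub> proj i v"

lemma proj_carrier: "\<lbrakk>i \<le> k; v \<in> carrier M\<rbrakk> \<Longrightarrow> proj i v \<in> carrier M"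
  using proj_mem F_carrier by blast

lemma linear_maps_part: "i < k \<Longrightarrow> part i \<in> linear_maps R M M"
  unfolding part_def by (intro linear_maps_minus linear_maps_proj) auto

lemma part_carrier: "\<lbrakk>i < k; v \<in> carrier M\<rbrakk> \<Longrightarrow> part i v \<in> carrier M"
  by (simp add: part_def proj_carrier)

lemma finsum_part:
  assumes v: "v \<in> carrier M"
  shows "(\<Oplus>\<^bsub>M\<^esub>i\<in>{..<k}. part i v) = v"
proof -
  have "(\<Oplus>\<^bsub>M\<^esub>i\<in>{..<k}. part i v) = proj k v \<ominus>\<^bsub>M\<^esub> proj 0 v"
    unfolding part_def by (rule finsum_telescope) (simp add: proj_carrier v)
  also have "\<dots> = v"
    using proj_left[of k v] proj_right[of 0 v] F_k E.F_k v by simp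
  finally show ?thesis .
qed

lemma part_mem_F:
  assumes "i < k" "v \<in> carrier M"
  shows "part i v \<in> F (Suc i)"
  unfolding part_def using assms proj_mem[of i v] proj_mem[of "Suc i" v] F_Suc[of i]
  by (auto intro!: F_minus)

text \<open>A difference of two projections is also the difference, in reverse order, of the two
  complementary components. These lie in \<open>E (k - i)\<close> and in the smaller
  \<open>E (k - Suc i)\<close>.\<close>

lemma part_mem_E:
  assumes "i < k" "v \<in> carrier M"
  shows "part i v \<in> E (k - i)"
proof -
  have "v \<ominus>\<^bsub>M\<^esub> proj (Suc i) v \<in> E (k - i)"
    by (rule E.F_mem_mono[OF minus_proj_mem]) (use assms in auto)
  then have "\<ominus>\<^bsub>M\<^esub> (v \<ominus>\<^bsub>M\<^esub> proj (Suc i) v) \<oplus>\<^bsub>M\<^esub> (v \<ominus>\<^bsub>M\<^esub> proj i v) \<in> E (k - i)"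
    using assms minus_proj_mem[of i v] by (intro E.F_add E.F_uminus) auto
  then show ?thesis
    using assms by (simp add: part_def uminus_minus minus_trans proj_carrier)
qed

text \<open>Both projections fix \<open>v\<close>. So elements of \<open>F j\<close> only have parts
  of index below \<open>j\<close>.\<close>

lemma part_zero_F:
  assumes "i < k" "j \<le> i" "v \<in> F j"
  shows "part i v = \<zero>\<^bsub>M\<^esub>"
proof -
  have "v \<in> F i" "v \<in> F (Suc i)" using F_mem_mono assms by auto
  moreover have "v \<in> carrier M" using F_carrier[of j v] assms by simp
  ultimately show ?thesis using assms(1) by (simp add: part_def proj_left)
qed

text \<open>Both projections kill \<open>v\<close>. So elements of \<open>E j\<close> only have
  parts of index at least \<open>k - j\<close>.\<close>

lemma part_zero_E:
  assumes "i < k" "j \<le> k - Suc i" "v \<in> E j"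
  shows "part i v = \<zero>\<^bsub>M\<^esub>"
proof -
  have "v \<in> E (k - i)" "v \<in> E (k - Suc i)" using E.F_mem_mono assms by auto
  then show ?thesis
    using assms by (simp add: part_def proj_right)
qed

text \<open>On \<open>F (Suc i)\<close> only the component in \<open>F i\<close> is subtracted, so
  \<open>part i\<close> induces the identity on the quotient by \<open>F i\<close>. As this holds
  for every transversal \<open>E\<close>, the summands of two such filtrations can be
  compared.\<close>

lemma part_minus_mem:
  assumes "i < k" "v \<in> F (Suc i)"
  shows "part i v \<ominus>\<^bsub>M\<^esub> v \<in> F i"
proof -
  have v: "v \<in> carrier M" using F_carrier[of "Suc i"] assms by simp
  have "part i v \<ominus>\<^bsub>M\<^esub> v = \<ominus>\<^bsub>M\<^esub> proj i v"
    using assms v by (simp add: part_def proj_left proj_carrier add_minus_cancel)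
  then show ?thesis using F_uminus[OF _ proj_mem] assms v by simp
qed

text \<open>An inclusion suffices because \<open>g\<close> preserves the common complement
  \<open>F (k - j)\<close>. If \<open>g v\<close> lies in \<open>E' j\<close>, let \<open>a\<close>
  be the component of \<open>v\<close> in \<open>F (k - j)\<close>; then \<open>g a\<close> lies in
  both \<open>F (k - j)\<close> and \<open>E' j\<close>, so \<open>g a\<close> and with it
  \<open>a\<close> vanish, and \<open>v\<close> lies in \<open>E j\<close>.\<close>

lemma image_E_eqI:
  assumes E': "transversal_filtrations R M F k E'"
    and g: "g \<in> linear_maps R M M" and u: "lowers 1 (\<lambda>v. g v \<ominus>\<^bsub>M\<^esub> v)"
    and sub: "\<And>j. j \<le> k \<Longrightarrow> g ` E j \<subseteq> E' j" and j: "j \<le> k"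
  shows "g ` E j = E' j"
proof (intro equalityI sub j subsetI)
  interpret E': transversal_filtrations R M F k E' by fact
  fix w assume w: "w \<in> E' j"
  then have wc: "w \<in> carrier M" using E'.E.F_carrier j by blast
  then obtain v where v: "v \<in> carrier M" "g v = w"
    using unipotent_bij[OF g u] by (metis bij_betw_def imageE)
  define a where "a = proj (k - j) v"
  have a: "a \<in> F (k - j)" "v \<ominus>\<^bsub>M\<^esub> a \<in> E j" "a \<in> carrier M"
    using proj_mem[of "k - j" v] minus_proj_mem[of "k - j" v] proj_carrier[of "k - j" v] v j
    by (auto simp: a_def)
  have gc: "g v \<in> carrier M" "g a \<in> carrier M" using linear_mapsD(1)[OF g] v a by auto
  have "g a = g v \<ominus>\<^bsub>M\<^esub> g (v \<ominus>\<^bsub>M\<^esub> a)"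
    using a(3) v(1) gc by (simp add: linear_map_minus[OF module_axioms g] add_minus_cancel)
  moreover have "g v \<ominus>\<^bsub>M\<^esub> g (v \<ominus>\<^bsub>M\<^esub> a) \<in> E' j"
    using sub[OF j] a(2) v(2) w by (intro E'.E.F_minus[OF j]) auto
  moreover have "g a \<in> F (k - j)" using unipotent_mem[OF g u _ a(1)] by simp
  ultimately have "g a \<in> F (k - j) \<inter> E' j" by simp
  then have "g a = \<zero>\<^bsub>M\<^esub>" using E'.direct[of "k - j"] j by (auto simp: is_direct_sum_def)
  then have "g a = g \<zero>\<^bsub>M\<^esub>" using linear_map_zero[OF module_axioms g] by simp
  then have "a = \<zero>\<^bsub>M\<^esub>"
    using unipotent_bij[OF g u] a(3) by (auto simp: bij_betw_def dest: inj_onD)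
  then show "w \<in> g ` E j" using a(2) v by auto
qed

text \<open>The summands of \<open>M\<close> given by \<open>E\<close> and by \<open>E'\<close> are both isomorphic to the successive
  quotients of \<open>F\<close>; the sum of the resulting isomorphisms maps \<open>E\<close> to \<open>E'\<close>.\<close>

lemma unipotent_transporter:
  assumes E': "transversal_filtrations R M F k E'"
  obtains g where "g \<in> linear_maps R M M" "lowers 1 (\<lambda>v. g v \<ominus>\<^bsub>M\<^esub> v)"
    "\<And>j. j \<le> k \<Longrightarrow> g ` E j = E' j"
proof -
  interpret E': transversal_filtrations R M F k E' by fact
  define g where "g v = (\<Oplus>\<^bsub>M\<^esub>i\<in>{..<k}. E'.part i (part i v))" for v
  have car: "E'.part i (part i v) \<in> carrier M" if "i < k" "v \<in> carrier M" for i v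
    using that by (simp add: part_carrier E'.part_carrier)
  have g: "g \<in> linear_maps R M M"
    unfolding g_def
    by (intro linear_maps_finsum linear_maps_comp[OF linear_maps_part E'.linear_maps_part]) auto
  have "g v \<ominus>\<^bsub>M\<^esub> v = (\<Oplus>\<^bsub>M\<^esub>i\<in>{..<k}. E'.part i (part i v) \<ominus>\<^bsub>M\<^esub> part i v)"
    if v: "v \<in> carrier M" for v
    using finsum_part[OF v] car[OF _ v] part_carrier[OF _ v]
    by (subst finsum_minus) (auto simp: g_def)
  moreover have "lowers 1 (\<lambda>v. \<Oplus>\<^bsub>M\<^esub>i\<in>{..<k}. E'.part i (part i v) \<ominus>\<^bsub>M\<^esub> part i v)"
  proof (intro lowers_finsum)
    fix i assume i: "i \<in> {..<k}"
    show "lowers 1 (\<lambda>v. E'.part i (part i v) \<ominus>\<^bsub>M\<^esub> part i v)"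
      unfolding lowers_def
    proof (intro allI impI ballI)
      fix j v assume j: "j \<le> k" and v: "v \<in> F j"
      have vc: "v \<in> carrier M" using F_carrier[OF j v] .
      \<comment> \<open>For \<open>j \<le> i\<close> the part is zero; otherwise it changes only by
        an element of \<open>F i\<close>, which is contained in \<open>F (j - 1)\<close>.\<close>
      show "E'.part i (part i v) \<ominus>\<^bsub>M\<^esub> part i v \<in> F (j - 1)"
      proof (cases "j \<le> i")
        case True
        then have "part i v = \<zero>\<^bsub>M\<^esub>" using part_zero_F v i by auto
        moreover have "E'.part i \<zero>\<^bsub>M\<^esub> = \<zero>\<^bsub>M\<^esub>"
          using linear_map_zero[OF module_axioms E'.linear_maps_part] i by simp
        ultimately show ?thesis using F_zero[of "j - 1"] j by simp
      next
        case False
        have "E'.part i (part i v) \<ominus>\<^bsub>M\<^esub> part i v \<in> F i"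
          using E'.part_minus_mem part_mem_F i vc by simp
        then show ?thesis by (rule F_mem_mono) (use False j in auto)
      qed
    qed
  qed simp
  ultimately have u: "lowers 1 (\<lambda>v. g v \<ominus>\<^bsub>M\<^esub> v)" using lowers_cong by fastforce
  have sub: "g ` E j \<subseteq> E' j" if j: "j \<le> k" for j
  proof (intro image_subsetI)
    fix v assume v: "v \<in> E j"
    have vc: "v \<in> carrier M" using E.F_carrier[OF j v] .
    show "g v \<in> E' j"
      unfolding g_def
    proof (intro E'.E.F_finsum[OF j])
      fix i assume i: "i \<in> {..<k}"
      \<comment> \<open>Either the part of \<open>v\<close> is zero, or \<open>k - i \<le> j\<close>
        and \<open>E' (k - i)\<close> is contained in \<open>E' j\<close>.\<close>
      show "E'.part i (part i v) \<in> E' j"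
      proof (cases "j \<le> k - Suc i")
        case True
        then have "part i v = \<zero>\<^bsub>M\<^esub>" using part_zero_E v i by auto
        moreover have "E'.part i \<zero>\<^bsub>M\<^esub> = \<zero>\<^bsub>M\<^esub>"
          using linear_map_zero[OF module_axioms E'.linear_maps_part] i by simp
        ultimately show ?thesis using E'.E.F_zero[OF j] by simp
      next
        case False
        have "E'.part i (part i v) \<in> E' (k - i)"
          using E'.part_mem_E part_carrier i vc by simp
        then show ?thesis by (rule E'.E.F_mem_mono) (use False j in auto)
      qed
    qed simp
  qed
  show thesis using image_E_eqI[OF E' g u sub] by (rule that[OF g u])
qed

text \<open>A part of \<open>v\<close> lies in \<open>F (Suc i)\<close> and in
  \<open>E (k - i)\<close>: being unipotent, \<open>g\<close> changes it by an element of
  \<open>F i\<close>, and preserving \<open>E\<close>, by an element of \<open>E (k - i)\<close>.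
  These two meet in zero.\<close>

lemma unipotent_stabilizer:
  assumes g: "g \<in> linear_maps R M M" and u: "lowers 1 (\<lambda>v. g v \<ominus>\<^bsub>M\<^esub> v)"
    and stab: "\<And>j. j \<le> k \<Longrightarrow> g ` E j \<subseteq> E j" and v: "v \<in> carrier M"
  shows "g v = v"
proof -
  have fix_part: "g (part i v) = part i v" if i: "i < k" for i
  proof -
    have "g (part i v) \<ominus>\<^bsub>M\<^esub> part i v \<in> F i"
      using lowersD[OF u _ part_mem_F[OF i v]] i by simp
    moreover have "g (part i v) \<ominus>\<^bsub>M\<^esub> part i v \<in> E (k - i)"
      using stab[of "k - i"] part_mem_E[OF i v] by (intro E.F_minus) auto
    ultimately have "g (part i v) \<ominus>\<^bsub>M\<^esub> part i v = \<zero>\<^bsub>M\<^esub>"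
      using direct[of i] i by (auto simp: is_direct_sum_def)
    then show ?thesis
      using part_carrier[OF i v] linear_mapsD(1)[OF g] by (simp add: minus_eq_zero_iff)
  qed
  have "g v = g (\<Oplus>\<^bsub>M\<^esub>i\<in>{..<k}. part i v)" by (simp add: finsum_part v)
  also have "\<dots> = (\<Oplus>\<^bsub>M\<^esub>i\<in>{..<k}. g (part i v))"
    using part_carrier v by (intro linear_map_finsum[OF module_axioms g]) auto
  also have "\<dots> = (\<Oplus>\<^bsub>M\<^esub>i\<in>{..<k}. part i v)"
    using part_carrier v fix_part by (intro M.finsum_cong') auto
  finally show ?thesis by (simp add: finsum_part v)
qed

text \<open>Apply \<open>g\<close> to the decompositions into \<open>F i\<close> and
  \<open>E (k - i)\<close>; the first summand is mapped onto itself.\<close>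

lemma unipotent_image_E:
  assumes g: "g \<in> linear_maps R M M" and u: "lowers 1 (\<lambda>v. g v \<ominus>\<^bsub>M\<^esub> v)"
  shows "transversal_filtrations R M F k (\<lambda>j. g ` E j)"
proof (intro transversal_filtrations.intro filtered_module_axioms transversal_filtrations_axioms.intro)
  have bij: "bij_betw g (carrier M) (carrier M)" by (rule unipotent_bij[OF g u])
  show "filtered_module R M (\<lambda>j. g ` E j) k"
  proof (intro filtered_module.intro module_axioms filtered_module_axioms.intro)
    show "g ` E 0 = {\<zero>\<^bsub>M\<^esub>}" using E.F_0 linear_map_zero[OF module_axioms g] by simp
    show "g ` E k = carrier M" using bij E.F_k by (simp add: bij_betw_def)
    show "g ` E i \<subseteq> g ` E (Suc i)" if "i < k" for i using E.F_Suc[OF that] by blast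
    show "submodule (g ` E i) R M" if "i \<le> k" for i
      using submodule_image[OF E.F_submodule[OF that] g] .
  qed
  show "is_direct_sum M (F i) (g ` E (k - i))" if "i \<le> k" for i
    using is_direct_sum_image[OF F_submodule[OF that] E_complement direct[OF that] g bij]
      unipotent_image[OF g u that] by simp
qed

end

section \<open>Transport of module structures\<close>

text \<open>By injectivity \<open>inv_into\<close> undoes \<open>h\<close> on the carrier, so each
  module law of the transported structure is the image under \<open>h\<close> of the same law in
  \<open>N\<close>.\<close>

lemma
  assumes "module R N" "inj_on h (carrier N)"
  shows module_transport: "module R (transport h N)"
    and transport_linear_iso: "h \<in> linear_isos R N (transport h N)"
proof -
  interpret N: module R N by fact
  define h' where "h' = inv_into (carrier N) h"
  have h'h [simp]: "h' (h x) = x" if "x \<in> carrier N" for x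
    using assms(2) that by (simp add: h'_def)
  have sel: "carrier (transport h N) = h ` carrier N" "\<zero>\<^bsub>transport h N\<^esub> = h \<zero>\<^bsub>N\<^esub>"
    "\<And>x y. x \<oplus>\<^bsub>transport h N\<^esub> y = h (h' x \<oplus>\<^bsub>N\<^esub> h' y)"
    "\<And>r x. r \<odot>\<^bsub>transport h N\<^esub> x = h (r \<odot>\<^bsub>N\<^esub> h' x)"
    by (simp_all add: transport_def Let_def h'_def)
  show "module R (transport h N)"
  proof (rule moduleI)
    show "abelian_group (transport h N)"
    proof (rule abelian_groupI)
      fix x assume "x \<in> carrier (transport h N)"
      then obtain u where u: "u \<in> carrier N" "x = h u" by (auto simp: sel)
      then show "\<exists>y\<in>carrier (transport h N). y \<oplus>\<^bsub>transport h N\<^esub> x = \<zero>\<^bsub>transport h N\<^esub>"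
        by (intro bexI[of _ "h (\<ominus>\<^bsub>N\<^esub> u)"]) (auto simp: sel N.M.l_neg)
    qed (auto simp: sel N.M.a_ac)
  qed (auto simp: sel N.R.is_cring N.smult_l_distr N.smult_r_distr N.smult_assoc1)
  show "h \<in> linear_isos R N (transport h N)"
    using assms(2) by (auto simp: linear_isos_def sel bij_betw_def intro!: linear_mapsI)
qed

lemma (in module) finsum_smult_rdistr:
  assumes "finite A" "c \<in> A \<rightarrow> carrier R" "x \<in> carrier M"
  shows "(\<Oplus>i\<in>A. c i) \<odot>\<^bsub>M\<^esub> x = (\<Oplus>\<^bsub>M\<^esub>i\<in>A. c i \<odot>\<^bsub>M\<^esub> x)"
  using assms by (induction A rule: finite_induct) (auto simp: Pi_def smult_l_distr)

text \<open>The two parametrisations differ by the translation by \<open>Z\<close>, and affine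
  combinations commute with translations.\<close>

lemma same_affine_structure_transport:
  assumes "module R N" "inj_on h (carrier N)" and Z: "Z \<in> carrier N"
    and h': "\<And>X. X \<in> carrier N \<Longrightarrow> h' X = h (X \<oplus>\<^bsub>N\<^esub> Z)"
  shows "same_affine_structure R (transport h N) (transport h' N)"
proof -
  interpret N: module R N by fact
  have inj': "inj_on h' (carrier N)"
  proof (rule inj_onI)
    fix x y assume xy: "x \<in> carrier N" "y \<in> carrier N" "h' x = h' y"
    have "x \<oplus>\<^bsub>N\<^esub> Z = y \<oplus>\<^bsub>N\<^esub> Z"
      by (rule inj_onD[OF assms(2), where x = "x \<oplus>\<^bsub>N\<^esub> Z"]) (use xy Z in \<open>auto simp: h'\<close>)
    then show "x = y" using xy Z by simp
  qed
  note m = module_transport[OF assms(1,2)] module_transport[OF assms(1) inj']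
  have l: "h \<in> linear_maps R N (transport h N)" "h' \<in> linear_maps R N (transport h' N)"
    using transport_linear_iso[OF assms(1,2)] transport_linear_iso[OF assms(1) inj']
    by (auto simp: linear_isos_def)
  interpret T: module R "transport h N" by (rule m)
  interpret T': module R "transport h' N" by (rule m)
  have car: "carrier (transport h N) = h ` carrier N" "carrier (transport h' N) = h' ` carrier N"
    by (simp_all add: transport_def Let_def)
  have shift: "h A = h' (A \<ominus>\<^bsub>N\<^esub> Z)" if "A \<in> carrier N" for A
    using that Z by (simp add: h' N.add_minus_cancel)
  have "h ` carrier N = h' ` carrier N"
  proof (intro equalityI image_subsetI)
    show "h A \<in> h' ` carrier N" if "A \<in> carrier N" for A
      unfolding shift[OF that] using that Z by (intro imageI) simp
    show "h' A \<in> h ` carrier N" if "A \<in> carrier N" for A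
      unfolding h'[OF that] using that Z by (intro imageI) simp
  qed
  moreover have "(\<Oplus>\<^bsub>transport h N\<^esub>i\<in>{..<n}. c i \<odot>\<^bsub>transport h N\<^esub> x i)
      = (\<Oplus>\<^bsub>transport h' N\<^esub>i\<in>{..<n}. c i \<odot>\<^bsub>transport h' N\<^esub> x i)"
    if c: "c \<in> {..<n} \<rightarrow> carrier R" and x: "x \<in> {..<n} \<rightarrow> carrier (transport h N)"
      and sum: "(\<Oplus>\<^bsub>R\<^esub>i\<in>{..<n}. c i) = \<one>\<^bsub>R\<^esub>" for n :: nat and c x
  proof -
    \<comment> \<open>\<open>A i\<close> is the coordinate of \<open>x i\<close> with respect to
      \<open>h\<close>; with respect to \<open>h'\<close> it is \<open>A i\<close> minus
      \<open>Z\<close>.\<close>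
    define A where "A i = inv_into (carrier N) h (x i)" for i
    have A: "A i \<in> carrier N" "h (A i) = x i" if "i \<in> {..<n}" for i
    proof -
      have "x i \<in> h ` carrier N" using x that car by auto
      then show "A i \<in> carrier N" "h (A i) = x i"
        unfolding A_def by (rule inv_into_into, rule f_inv_into_f)
    qed
    have cA: "(\<lambda>i. c i \<odot>\<^bsub>N\<^esub> A i) \<in> {..<n} \<rightarrow> carrier N" and cZ: "(\<lambda>i. c i \<odot>\<^bsub>N\<^esub> Z) \<in> {..<n} \<rightarrow> carrier N"
      and cAZ: "(\<lambda>i. c i \<odot>\<^bsub>N\<^esub> (A i \<ominus>\<^bsub>N\<^esub> Z)) \<in> {..<n} \<rightarrow> carrier N"
      using c A Z by auto
    have hx: "h (c i \<odot>\<^bsub>N\<^esub> A i) = c i \<odot>\<^bsub>transport h N\<^esub> x i"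
      "h' (c i \<odot>\<^bsub>N\<^esub> (A i \<ominus>\<^bsub>N\<^esub> Z)) = c i \<odot>\<^bsub>transport h' N\<^esub> x i" if "i \<in> {..<n}" for i
    proof -
      have "c i \<in> carrier R" using c that by auto
      then show "h (c i \<odot>\<^bsub>N\<^esub> A i) = c i \<odot>\<^bsub>transport h N\<^esub> x i"
        "h' (c i \<odot>\<^bsub>N\<^esub> (A i \<ominus>\<^bsub>N\<^esub> Z)) = c i \<odot>\<^bsub>transport h' N\<^esub> x i"
        using A[OF that] Z linear_mapsD(3)[OF l(1)] linear_mapsD(3)[OF l(2)] shift[OF A(1)[OF that]]
        by auto
    qed
    have "(\<Oplus>\<^bsub>transport h N\<^esub>i\<in>{..<n}. c i \<odot>\<^bsub>transport h N\<^esub> x i)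
        = (\<Oplus>\<^bsub>transport h N\<^esub>i\<in>{..<n}. h (c i \<odot>\<^bsub>N\<^esub> A i))"
      using hx(1) cA linear_mapsD(1)[OF l(1)] by (intro T.M.finsum_cong') auto
    also have "\<dots> = h (\<Oplus>\<^bsub>N\<^esub>i\<in>{..<n}. c i \<odot>\<^bsub>N\<^esub> A i)"
      using N.linear_map_finsum[OF m(1) l(1) _ cA] by simp
    \<comment> \<open>The coefficients have sum one, so the single \<open>Z\<close> to be subtracted
      may carry that sum as a factor and be distributed over the terms.\<close>
    also have "\<dots> = h' ((\<Oplus>\<^bsub>N\<^esub>i\<in>{..<n}. c i \<odot>\<^bsub>N\<^esub> A i) \<ominus>\<^bsub>N\<^esub> (\<Oplus>\<^bsub>R\<^esub>i\<in>{..<n}. c i) \<odot>\<^bsub>N\<^esub> Z)"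
      using shift cA Z by (simp add: sum)
    also have "\<dots> = h' (\<Oplus>\<^bsub>N\<^esub>i\<in>{..<n}. c i \<odot>\<^bsub>N\<^esub> A i \<ominus>\<^bsub>N\<^esub> c i \<odot>\<^bsub>N\<^esub> Z)"
      using N.finsum_minus[OF _ cA cZ] N.finsum_smult_rdistr[OF _ c Z] by simp
    also have "\<dots> = h' (\<Oplus>\<^bsub>N\<^esub>i\<in>{..<n}. c i \<odot>\<^bsub>N\<^esub> (A i \<ominus>\<^bsub>N\<^esub> Z))"
      using c A Z cAZ by (intro arg_cong[of _ _ h'] N.M.finsum_cong') (auto simp: N.smult_minus_distr Pi_def)
    also have "\<dots> = (\<Oplus>\<^bsub>transport h' N\<^esub>i\<in>{..<n}. h' (c i \<odot>\<^bsub>N\<^esub> (A i \<ominus>\<^bsub>N\<^esub> Z)))"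
      using N.linear_map_finsum[OF m(2) l(2) _ cAZ] by simp
    also have "\<dots> = (\<Oplus>\<^bsub>transport h' N\<^esub>i\<in>{..<n}. c i \<odot>\<^bsub>transport h' N\<^esub> x i)"
    proof (rule T'.M.finsum_cong')
      show "(\<lambda>i. c i \<odot>\<^bsub>transport h' N\<^esub> x i) \<in> {..<n} \<rightarrow> carrier (transport h' N)"
        using c x T'.smult_closed unfolding car \<open>h ` carrier N = h' ` carrier N\<close>
        by (auto simp: Pi_def)
    qed (use hx(2) in auto)
    finally show ?thesis .
  qed
  ultimately show ?thesis by (simp add: same_affine_structure_def car)
qed


section \<open>Endomorphisms and automorphisms\<close>

context module
begin

lemma module_End_module: "module R (End_module R M)"
proof -
  have rst: "(\<lambda>v\<in>carrier M. X v) \<in> linear_maps R M M" if "X \<in> linear_maps R M M" for X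
    by (rule linear_maps_cong[OF that module_axioms]) simp
  have car: "X v \<in> carrier M" if "X \<in> linear_maps R M M" "v \<in> carrier M" for X v
    using linear_mapsD(1)[OF that] .
  show ?thesis
  proof (rule moduleI)
    show "abelian_group (End_module R M)"
    proof (rule abelian_groupI)
      fix X assume X: "X \<in> carrier (End_module R M)"
      show "\<exists>Y\<in>carrier (End_module R M). Y \<oplus>\<^bsub>End_module R M\<^esub> X = \<zero>\<^bsub>End_module R M\<^esub>"
        using X by (intro bexI[of _ "\<lambda>v\<in>carrier M. \<zero>\<^bsub>M\<^esub> \<ominus>\<^bsub>M\<^esub> X v"])
          (auto simp: End_module_def car add_minus_cancel intro!: rst linear_maps_minus linear_maps_zero)
    qed (auto simp: End_module_def car M.a_ac intro!: rst linear_maps_add linear_maps_zero extensionalityI[of _ "carrier M"])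
  qed (auto simp: End_module_def car R.is_cring smult_l_distr smult_r_distr smult_assoc1
      intro!: rst linear_maps_smult extensionalityI[of _ "carrier M"])
qed

text \<open>The group laws of \<open>GL\<close> are inherited from the permutations of the carrier.
  The inverse is linear because the two sides of each linearity law become equal under the injective
  \<open>g\<close>.\<close>

lemma Bij_linear_subgroup: "subgroup (linear_maps R M M \<inter> Bij (carrier M)) (BijGroup (carrier M))"
proof (rule group.subgroupI[OF group_BijGroup])
  show "linear_maps R M M \<inter> Bij (carrier M) \<subseteq> carrier (BijGroup (carrier M))"
    by (auto simp: BijGroup_def)
  have "(\<lambda>v\<in>carrier M. v) \<in> linear_maps R M M"
    by (rule linear_maps_cong[OF linear_maps_id module_axioms]) simp
  then show "linear_maps R M M \<inter> Bij (carrier M) \<noteq> {}"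
    using id_Bij[of "carrier M"] by blast
  fix g assume g: "g \<in> linear_maps R M M \<inter> Bij (carrier M)"
  then have gB: "g \<in> Bij (carrier M)" and gl: "g \<in> linear_maps R M M" by auto
  let ?h = "\<lambda>v\<in>carrier M. inv_into (carrier M) g v"
  have h: "inv_into (carrier M) g v \<in> carrier M" "g (inv_into (carrier M) g v) = v"
    if "v \<in> carrier M" for v
    using Bij_inv_into_mem[OF gB that] gB that
    by (auto simp: Bij_def bij_betw_def f_inv_into_f)
  have inj: "v = w" if "g v = g w" "v \<in> carrier M" "w \<in> carrier M" for v w
    using gB that by (auto simp: Bij_def bij_betw_def dest: inj_onD)
  have "?h \<in> linear_maps R M M"
  proof (rule linear_mapsI)
    fix v w assume v: "v \<in> carrier M" and w: "w \<in> carrier M"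
    show "?h (v \<oplus>\<^bsub>M\<^esub> w) = ?h v \<oplus>\<^bsub>M\<^esub> ?h w"
      by (rule inj) (use v w h in \<open>simp_all add: linear_mapsD(2)[OF gl]\<close>)
  next
    fix r v assume r: "r \<in> carrier R" and v: "v \<in> carrier M"
    show "?h (r \<odot>\<^bsub>M\<^esub> v) = r \<odot>\<^bsub>M\<^esub> ?h v"
      by (rule inj) (use v r h in \<open>simp_all add: linear_mapsD(3)[OF gl]\<close>)
  qed (use h in simp)
  then show "inv\<^bsub>BijGroup (carrier M)\<^esub> g \<in> linear_maps R M M \<inter> Bij (carrier M)"
    using gB by (simp add: inv_BijGroup restrict_inv_into_Bij)
  fix g' assume g': "g' \<in> linear_maps R M M \<inter> Bij (carrier M)"
  then have g'l: "g' \<in> linear_maps R M M" by simp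
  have "compose (carrier M) g g' \<in> linear_maps R M M"
    by (rule linear_maps_cong[OF linear_maps_comp[OF g'l gl] module_axioms]) (simp add: compose_def)
  then show "g \<otimes>\<^bsub>BijGroup (carrier M)\<^esub> g' \<in> linear_maps R M M \<inter> Bij (carrier M)"
    using g g' by (simp add: BijGroup_def compose_Bij)
qed

lemma group_GL: "group (GL R M)"
  unfolding GL_def by (rule group.subgroup_imp_group[OF group_BijGroup Bij_linear_subgroup])

lemma GL_carrier: "carrier (GL R M) = linear_maps R M M \<inter> Bij (carrier M)"
  by (simp add: GL_def)

lemma GL_one: "\<one>\<^bsub>GL R M\<^esub> = (\<lambda>v\<in>carrier M. v)"
  by (simp add: GL_def BijGroup_def)

lemma GL_mult:
  assumes "g \<in> carrier (GL R M)" "h \<in> carrier (GL R M)"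
  shows "g \<otimes>\<^bsub>GL R M\<^esub> h = compose (carrier M) g h"
  using assms by (simp add: GL_def BijGroup_def)

lemma GL_inv:
  assumes "g \<in> carrier (GL R M)" "v \<in> carrier M"
  shows "(inv\<^bsub>GL R M\<^esub> g) (g v) = v"
proof -
  interpret GL: group "GL R M" by (rule group_GL)
  have "compose (carrier M) (inv\<^bsub>GL R M\<^esub> g) g = (\<lambda>v\<in>carrier M. v)"
    using GL.l_inv[OF assms(1)] GL_mult[OF GL.inv_closed[OF assms(1)] assms(1)] by (simp add: GL_one)
  then show ?thesis using assms(2) by (metis compose_eq restrict_apply')
qed

end

text \<open>An action is formally a homomorphism into the extensional bijections of
  \<open>E\<close>. This reduces it to the usual axioms: bijectivity comes from the action of the
  inverse element.\<close>

lemma (in group) group_action_restrictI: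
  assumes closed: "\<And>g x. \<lbrakk>g \<in> carrier G; x \<in> E\<rbrakk> \<Longrightarrow> \<phi> g x \<in> E"
    and one: "\<And>x. x \<in> E \<Longrightarrow> \<phi> \<one> x = x"
    and mult: "\<And>g h x. \<lbrakk>g \<in> carrier G; h \<in> carrier G; x \<in> E\<rbrakk> \<Longrightarrow> \<phi> (g \<otimes> h) x = \<phi> g (\<phi> h x)"
  shows "group_action G E (\<lambda>g. \<lambda>x\<in>E. \<phi> g x)"
proof -
  have Bij: "(\<lambda>x\<in>E. \<phi> g x) \<in> Bij E" if g: "g \<in> carrier G" for g
  proof -
    have "bij_betw (\<phi> g) E E"
      using closed mult[of "inv g" g] mult[of g "inv g"] one g
      by (intro bij_betw_byWitness[where f' = "\<phi> (inv g)"]) auto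
    then show ?thesis by (simp add: Bij_def bij_betw_restrict_eq)
  qed
  have "(\<lambda>g. \<lambda>x\<in>E. \<phi> g x) \<in> hom G (BijGroup E)"
  proof (rule homI)
    show "(\<lambda>x\<in>E. \<phi> g x) \<in> carrier (BijGroup E)" if "g \<in> carrier G" for g
      using Bij[OF that] by (simp add: BijGroup_def)
    show "(\<lambda>x\<in>E. \<phi> (g \<otimes> h) x) = (\<lambda>x\<in>E. \<phi> g x) \<otimes>\<^bsub>BijGroup E\<^esub> (\<lambda>x\<in>E. \<phi> h x)"
      if "g \<in> carrier G" "h \<in> carrier G" for g h
      using Bij[OF that(1)] Bij[OF that(2)] mult[OF that] closed[OF that(2)]
      by (simp add: BijGroup_def compose_def cong: restrict_cong)
  qed
  then show ?thesis
    by (intro group_action.intro group_hom.intro group_hom_axioms.intro group_axioms group_BijGroup)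
qed

section \<open>Flags\<close>

lemma flag_nth_0 [simp]: "flag_nth M f 0 = {\<zero>\<^bsub>M\<^esub>}"
  by (simp add: flag_nth_def)

lemma flag_eqI:
  assumes "length f = k" "length e = k" "\<And>i. i \<le> k \<Longrightarrow> flag_nth M f i = flag_nth M e i"
  shows "f = e"
proof (rule nth_equalityI)
  show "f ! i = e ! i" if "i < length f" for i
    using assms(3)[of "Suc i"] assms(1) that by (simp add: flag_nth_def)
qed (use assms in simp)

context module
begin

lemma flag_filtered:
  assumes "flag R M k f"
  shows "filtered_module R M (flag_nth M f) k"
proof (intro filtered_module.intro module_axioms filtered_module_axioms.intro)
  show "submodule (flag_nth M f i) R M" if "i \<le> k" for i
    using assms that submodule_zero_set by (cases i) (auto simp: flag_def)
  show "flag_nth M f i \<subseteq> flag_nth M f (Suc i)" if "i < k" for i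
    using assms that by (auto simp: flag_def Ball_def dest!: spec[of _ "Suc i"])
qed (use assms in \<open>auto simp: flag_def\<close>)

text \<open>The bridge from flags to filtrations. Beyond transversality of flags there is the index
  0, where the direct sum is that of zero and the whole module.\<close>

lemma transversal_iff:
  assumes "flag R M k f" "flag R M k e"
  shows "transversal M k f e \<longleftrightarrow> transversal_filtrations R M (flag_nth M f) k (flag_nth M e)"
proof
  interpret F: filtered_module R M "flag_nth M f" k by (rule flag_filtered[OF assms(1)])
  interpret E: filtered_module R M "flag_nth M e" k by (rule flag_filtered[OF assms(2)])
  assume T: "transversal M k f e"
  show "transversal_filtrations R M (flag_nth M f) k (flag_nth M e)"
  proof (intro transversal_filtrations.intro F.filtered_module_axioms
      transversal_filtrations_axioms.intro E.filtered_module_axioms)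
    fix i assume i: "i \<le> k"
    show "is_direct_sum M (flag_nth M f i) (flag_nth M e (k - i))"
    proof (cases i)
      case 0
      have "{\<zero>\<^bsub>M\<^esub>} <+>\<^bsub>M\<^esub> carrier M = carrier M"
        by (auto simp: set_add_def')
      then show ?thesis using 0 E.F_k by (auto simp: is_direct_sum_def)
    next
      case (Suc j)
      then show ?thesis using T i by (simp add: transversal_def)
    qed
  qed
next
  assume "transversal_filtrations R M (flag_nth M f) k (flag_nth M e)"
  then show "transversal M k f e"
    by (simp add: transversal_def transversal_filtrations.direct)
qed

text \<open>Replace \<open>i\<close> by \<open>k - i\<close>. The case \<open>i = k\<close> calls on
  the condition at index 0, available in the filtration version.\<close>

lemma transversal_sym:
  assumes "flag R M k f" "flag R M k e" "transversal M k f e"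
  shows "transversal M k e f"
proof -
  interpret transversal_filtrations R M "flag_nth M f" k "flag_nth M e"
    using transversal_iff[OF assms(1,2)] assms(3) by simp
  have "is_direct_sum M (flag_nth M e i) (flag_nth M f (k - i))" if "i \<le> k" for i
    using is_direct_sum_sym[OF F_submodule E.F_submodule direct[of "k - i"]] that by simp
  then show ?thesis by (simp add: transversal_def)
qed

section \<open>The action of linear bijections on flags\<close>

lemma flag_nth_act:
  assumes "g \<in> linear_maps R M M" "i \<le> length e"
  shows "flag_nth M (act g e) i = g ` flag_nth M e i"
  using assms linear_map_zero[OF module_axioms assms(1)]
  by (cases i) (auto simp: flag_nth_def act_def)

lemma flag_act:
  assumes "g \<in> linear_maps R M M" "bij_betw g (carrier M) (carrier M)" "flag R M k e"
  shows "flag R M k (act g e)"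
proof -
  interpret E: filtered_module R M "flag_nth M e" k by (rule flag_filtered[OF assms(3)])
  have len: "length e = k" using assms(3) by (simp add: flag_def)
  note nth = flag_nth_act[OF assms(1), of _ e, unfolded len]
  have "submodule (flag_nth M (act g e) i) R M \<and>
      flag_nth M (act g e) (i - 1) \<subset> flag_nth M (act g e) i" if i: "i \<in> {1..k}" for i
  proof
    show "submodule (flag_nth M (act g e) i) R M"
      using submodule_image[OF E.F_submodule assms(1)] i by (simp add: nth)
    have "flag_nth M e (i - 1) \<subset> flag_nth M e i" "flag_nth M e i \<subseteq> carrier M"
      using assms(3) i E.F_mono[of i k] E.F_k by (auto simp: flag_def)
    \<comment> \<open>Injectivity of \<open>g\<close> on the carrier keeps the inclusion
      strict.\<close>
    then have "g ` flag_nth M e (i - 1) \<subset> g ` flag_nth M e i"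
      using assms(2) by (intro image_strict_mono) (auto simp: bij_betw_def intro: inj_on_subset)
    moreover have "i - 1 \<le> k" "i \<le> k" using i by auto
    ultimately show "flag_nth M (act g e) (i - 1) \<subset> flag_nth M (act g e) i"
      by (simp only: nth)
  qed
  moreover have "flag_nth M (act g e) k = carrier M"
    using assms(2) E.F_k by (simp add: nth bij_betw_def)
  ultimately show ?thesis using len by (simp add: flag_def act_def)
qed

text \<open>The members of a flag lie in the carrier, so \<open>act\<close> does not see values
  outside it; a map and its restriction act alike.\<close>

lemma act_cong:
  assumes "flag R M k e" "\<And>v. v \<in> carrier M \<Longrightarrow> g v = h v"
  shows "act g e = act h e"
proof -
  interpret E: filtered_module R M "flag_nth M e" k by (rule flag_filtered[OF assms(1)])
  have "N \<subseteq> carrier M" if "N \<in> set e" for N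
  proof -
    from that obtain i where "i < k" "N = flag_nth M e (Suc i)"
      using assms(1) by (auto simp: in_set_conv_nth flag_def flag_nth_def)
    then show ?thesis using E.F_carrier[of "Suc i"] by auto
  qed
  then show ?thesis using assms(2) by (auto simp: act_def intro!: image_cong)
qed

lemma act_id:
  assumes "flag R M k e"
  shows "act (\<lambda>v\<in>carrier M. v) e = e"
proof -
  have "act (\<lambda>v\<in>carrier M. v) e = act (\<lambda>v. v) e" by (rule act_cong[OF assms]) simp
  also have "\<dots> = e" unfolding act_def by (rule map_idI) simp
  finally show ?thesis .
qed

lemma act_compose:
  assumes "flag R M k e"
  shows "act (compose (carrier M) g h) e = act g (act h e)"
proof -
  have "act (compose (carrier M) g h) e = act (g \<circ> h) e"
    by (rule act_cong[OF assms]) (simp add: compose_eq)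
  also have "\<dots> = act g (act h e)" by (simp add: act_def image_comp)
  finally show ?thesis .
qed

end

section \<open>The group U(f) and its simply transitive action on the transversal flags\<close>

locale flagged_module = module +
  fixes k :: nat and f :: "'c set list"
  assumes flag: "flag R M k f"
begin

sublocale filtered_module R M "flag_nth M f" k
  by (rule flag_filtered[OF flag])

abbreviation "U \<equiv> U_grp R M k f"
abbreviation "u \<equiv> u_alg R M k f"

text \<open>The definitions of u(f) and U(f) start at index 1, \<open>lowers\<close> at index 0; the
  remaining case is that zero goes to zero.\<close>

lemma lowers_1_iff:
  assumes "X \<zero>\<^bsub>M\<^esub> = \<zero>\<^bsub>M\<^esub>"
  shows "lowers 1 X \<longleftrightarrow> (\<forall>i\<in>{1..k}. X ` flag_nth M f i \<subseteq> flag_nth M f (i - 1))"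
proof
  assume "\<forall>i\<in>{1..k}. X ` flag_nth M f i \<subseteq> flag_nth M f (i - 1)"
  then have "X v \<in> flag_nth M f (i - 1)" if "i \<le> k" "v \<in> flag_nth M f i" for i v
    using that assms by (cases i) fastforce+
  then show "lowers 1 X" by (simp add: lowers_def)
qed (auto simp: lowers_def)

lemma u_iff: "X \<in> u \<longleftrightarrow> X \<in> linear_maps R M M \<and> X \<in> extensional (carrier M) \<and> lowers 1 X"
  using lowers_1_iff[of X] linear_map_zero[OF module_axioms, of X]
  by (auto simp: u_alg_def End_module_def simp del: One_nat_def)

text \<open>Bijectivity is absent on the right because \<open>unipotent_bij\<close> supplies
  it.\<close>

lemma U_iff: "g \<in> U \<longleftrightarrow> g \<in> linear_maps R M M \<and> g \<in> extensional (carrier M) \<and>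
    lowers 1 (\<lambda>v. g v \<ominus>\<^bsub>M\<^esub> v)"
proof -
  have "lowers 1 (\<lambda>v. g v \<ominus>\<^bsub>M\<^esub> v) \<longleftrightarrow>
      (\<forall>i\<in>{1..k}. (\<lambda>v. g v \<ominus>\<^bsub>M\<^esub> v) ` flag_nth M f i \<subseteq> flag_nth M f (i - 1))"
    if "g \<in> linear_maps R M M"
    using linear_map_zero[OF module_axioms that] by (intro lowers_1_iff) simp
  then show ?thesis
    using unipotent_bij[of g] by (auto simp: U_grp_def GL_carrier Bij_def simp del: One_nat_def)
qed

lemma U_linear: "g \<in> U \<Longrightarrow> g \<in> linear_maps R M M"
  and U_unipotent: "g \<in> U \<Longrightarrow> lowers 1 (\<lambda>v. g v \<ominus>\<^bsub>M\<^esub> v)"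
  by (auto simp: U_iff)

lemma U_GL: "g \<in> U \<Longrightarrow> g \<in> carrier (GL R M)"
  by (simp add: U_grp_def)

lemma U_I:
  assumes "g \<in> linear_maps R M M" "lowers 1 (\<lambda>v. g v \<ominus>\<^bsub>M\<^esub> v)"
  shows "(\<lambda>v\<in>carrier M. g v) \<in> U"
  unfolding U_iff
proof (intro conjI)
  show "(\<lambda>v\<in>carrier M. g v) \<in> linear_maps R M M"
    by (rule linear_maps_cong[OF assms(1) module_axioms]) simp
  show "lowers 1 (\<lambda>v. (\<lambda>v\<in>carrier M. g v) v \<ominus>\<^bsub>M\<^esub> v)"
    by (rule lowers_cong[OF assms(2)]) simp
qed simp

text \<open>For the inverse, write v = g w, so that its difference from the identity at
  \<open>v\<close> is -(g w - w). For products, g g' - 1 = (g - 1) g' + (g' - 1), where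
  \<open>g'\<close> preserves the filtration.\<close>

lemma subgroup_U: "subgroup U (GL R M)"
proof (rule group.subgroupI[OF group_GL])
  show "U \<subseteq> carrier (GL R M)" using U_GL by auto
  have "(\<lambda>v\<in>carrier M. v) \<in> U"
    by (rule U_I[OF linear_maps_id], rule lowers_cong[OF lowers_zero]) simp
  then show "U \<noteq> {}" by auto
  fix g assume g: "g \<in> U"
  note gl = U_linear[OF g] and gu = U_unipotent[OF g]
  let ?h = "inv\<^bsub>GL R M\<^esub> g"
  have h: "?h \<in> carrier (GL R M)"
    using group.inv_closed[OF group_GL U_GL[OF g]] .
  have "lowers 1 (\<lambda>v. ?h v \<ominus>\<^bsub>M\<^esub> v)"
    unfolding lowers_def
  proof (intro allI impI ballI)
    fix i v assume i: "i \<le> k" and "v \<in> flag_nth M f i"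
    then obtain w where w: "w \<in> flag_nth M f i" "v = g w"
      using unipotent_image[OF gl gu i] by auto
    have wc: "w \<in> carrier M" using F_carrier[OF i w(1)] .
    have "\<ominus>\<^bsub>M\<^esub> (g w \<ominus>\<^bsub>M\<^esub> w) \<in> flag_nth M f (i - 1)"
      using lowersD[OF gu i w(1)] i by (intro F_uminus) auto
    then show "?h v \<ominus>\<^bsub>M\<^esub> v \<in> flag_nth M f (i - 1)"
      using w wc linear_mapsD(1)[OF gl] by (simp add: GL_inv[OF U_GL[OF g]] uminus_minus)
  qed
  then show "?h \<in> U" using h by (simp add: U_iff GL_carrier Bij_def)
  fix g' assume g': "g' \<in> U"
  note g'l = U_linear[OF g'] and g'u = U_unipotent[OF g']
  have "(\<lambda>v\<in>carrier M. g (g' v)) \<in> U"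
  proof (rule U_I[OF linear_maps_comp[OF g'l gl]])
    have "lowers 0 g'" unfolding lowers_def using unipotent_mem[OF g'l g'u] by simp
    then have "lowers 1 (\<lambda>v. g (g' v) \<ominus>\<^bsub>M\<^esub> g' v)"
      using lowers_comp[OF gu, of 0 g'] by simp
    from lowers_add[OF this g'u] show "lowers 1 (\<lambda>v. g (g' v) \<ominus>\<^bsub>M\<^esub> v)"
      by (rule lowers_cong) (simp add: minus_trans linear_mapsD(1)[OF gl] linear_mapsD(1)[OF g'l])
  qed
  then show "g \<otimes>\<^bsub>GL R M\<^esub> g' \<in> U"
    using GL_mult[OF U_GL[OF g] U_GL[OF g']] by (simp add: compose_def)
qed

lemma transversal_flagsD:
  assumes "e \<in> transversal_flags R M k f"
  shows "flag R M k e" "length e = k"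
    "transversal_filtrations R M (flag_nth M f) k (flag_nth M e)"
  using assms transversal_iff[OF flag] by (auto simp: transversal_flags_def flag_def)

lemma act_U_closed:
  assumes g: "g \<in> U" and e: "e \<in> transversal_flags R M k f"
  shows "act g e \<in> transversal_flags R M k f"
proof -
  note gl = U_linear[OF g] and gu = U_unipotent[OF g]
  interpret T: transversal_filtrations R M "flag_nth M f" k "flag_nth M e"
    by (rule transversal_flagsD[OF e])
  have fl: "flag R M k (act g e)"
    by (rule flag_act[OF gl unipotent_bij[OF gl gu] transversal_flagsD(1)[OF e]])
  have "is_direct_sum M (flag_nth M f i) (flag_nth M (act g e) (k - i))" if "i \<le> k" for i
    using transversal_filtrations.direct[OF T.unipotent_image_E[OF gl gu] that]
    by (simp add: flag_nth_act[OF gl] transversal_flagsD(2)[OF e])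
  with fl show ?thesis by (simp add: transversal_flags_def transversal_def)
qed

lemma U_transitive:
  assumes e: "e \<in> transversal_flags R M k f" and e': "e' \<in> transversal_flags R M k f"
  obtains g where "g \<in> U" "act g e = e'"
proof -
  interpret T: transversal_filtrations R M "flag_nth M f" k "flag_nth M e"
    by (rule transversal_flagsD[OF e])
  obtain g where g: "g \<in> linear_maps R M M" "lowers 1 (\<lambda>v. g v \<ominus>\<^bsub>M\<^esub> v)"
    "\<And>j. j \<le> k \<Longrightarrow> g ` flag_nth M e j = flag_nth M e' j"
    using T.unipotent_transporter[OF transversal_flagsD(3)[OF e']] by blast
  have "act g e = e'"
  proof (rule flag_eqI)
    show "length (act g e) = k" "length e' = k"
      using transversal_flagsD(2) e e' by (auto simp: act_def)
    show "flag_nth M (act g e) i = flag_nth M e' i" if "i \<le> k" for i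
      using that g(3) by (simp add: flag_nth_act[OF g(1)] transversal_flagsD(2)[OF e])
  qed
  then have "act (\<lambda>v\<in>carrier M. g v) e = e'"
    using act_cong[OF transversal_flagsD(1)[OF e], of "\<lambda>v\<in>carrier M. g v" g] by simp
  then show thesis using that U_I[OF g(1,2)] by blast
qed

lemma U_stabilizer:
  assumes g: "g \<in> U" and e: "e \<in> transversal_flags R M k f" and stab: "act g e = e"
  shows "g = \<one>\<^bsub>GL R M\<^esub>"
proof -
  note gl = U_linear[OF g] and gu = U_unipotent[OF g]
  interpret T: transversal_filtrations R M "flag_nth M f" k "flag_nth M e"
    by (rule transversal_flagsD[OF e])
  have "g ` flag_nth M e j \<subseteq> flag_nth M e j" if "j \<le> k" for j
    using flag_nth_act[OF gl, of j e] stab transversal_flagsD(2)[OF e] that by simp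
  then have "g v = v" if "v \<in> carrier M" for v
    using T.unipotent_stabilizer[OF gl gu _ that] by blast
  then show ?thesis
    using g by (auto simp: GL_one U_iff intro!: extensionalityI[of _ "carrier M"])
qed

lemma act_U_mult:
  assumes "g \<in> U" "h \<in> U" "e \<in> transversal_flags R M k f"
  shows "act (g \<otimes>\<^bsub>GL R M\<^esub> h) e = act g (act h e)"
  using GL_mult[OF U_GL[OF assms(1)] U_GL[OF assms(2)]] act_compose[OF transversal_flagsD(1)[OF assms(3)]]
  by simp

text \<open>If \<open>g\<close> and \<open>h\<close> move \<open>e\<close> to the same flag, the
  product of the inverse of \<open>h\<close> with \<open>g\<close> stabilises
  \<open>e\<close>.\<close>

lemma U_simple:
  assumes g: "g \<in> U" and h: "h \<in> U" and e: "e \<in> transversal_flags R M k f"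
    and eq: "act g e = act h e"
  shows "g = h"
proof -
  interpret GL: group "GL R M" by (rule group_GL)
  interpret U: subgroup U "GL R M" by (rule subgroup_U)
  let ?h' = "inv\<^bsub>GL R M\<^esub> h"
  have h': "?h' \<in> U" using h by (rule U.m_inv_closed)
  have "act (?h' \<otimes>\<^bsub>GL R M\<^esub> g) e = act (?h' \<otimes>\<^bsub>GL R M\<^esub> h) e"
    using act_U_mult[OF h' g e] act_U_mult[OF h' h e] eq by simp
  also have "\<dots> = e"
    using act_id[OF transversal_flagsD(1)[OF e]] U_GL[OF h] by (simp add: GL_one)
  finally have "?h' \<otimes>\<^bsub>GL R M\<^esub> g = \<one>\<^bsub>GL R M\<^esub>"
    using U_stabilizer[OF U.m_closed[OF h' g] e] by simp
  then show ?thesis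
    using GL.inv_solve_left'[of "\<one>\<^bsub>GL R M\<^esub>" h g] U_GL[OF g] U_GL[OF h] by simp
qed

lemma simply_transitive_U:
  "simply_transitive_action ((GL R M)\<lparr>carrier := U\<rparr>)
    (transversal_flags R M k f) (\<lambda>g. \<lambda>e\<in>transversal_flags R M k f. act g e)"
proof (intro simply_transitive_action.intro transitive_action.intro)
  interpret group "(GL R M)\<lparr>carrier := U\<rparr>"
    by (rule group.subgroup_imp_group[OF group_GL subgroup_U])
  show "group_action ((GL R M)\<lparr>carrier := U\<rparr>)
    (transversal_flags R M k f) (\<lambda>g. \<lambda>e\<in>transversal_flags R M k f. act g e)"
  proof (rule group_action_restrictI)
    show "act \<one>\<^bsub>(GL R M)\<lparr>carrier := U\<rparr>\<^esub> e = e" if "e \<in> transversal_flags R M k f" for e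
      using act_id[OF transversal_flagsD(1)[OF that]] by (simp add: GL_one)
  qed (auto simp: act_U_closed act_U_mult)
  show "transitive_action_axioms ((GL R M)\<lparr>carrier := U\<rparr>)
    (transversal_flags R M k f) (\<lambda>g. \<lambda>e\<in>transversal_flags R M k f. act g e)"
  proof
    fix e e' assume e: "e \<in> transversal_flags R M k f" "e' \<in> transversal_flags R M k f"
    obtain g where "g \<in> U" "act g e = e'" using U_transitive[OF e] .
    then show "\<exists>g\<in>carrier ((GL R M)\<lparr>carrier := U\<rparr>).
        (\<lambda>e\<in>transversal_flags R M k f. act g e) e = e'"
      using e by auto
  qed
  show "simply_transitive_action_axioms ((GL R M)\<lparr>carrier := U\<rparr>)
    (transversal_flags R M k f) (\<lambda>g. \<lambda>e\<in>transversal_flags R M k f. act g e)"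
  proof
    fix e g h assume "e \<in> transversal_flags R M k f" "g \<in> carrier ((GL R M)\<lparr>carrier := U\<rparr>)"
      "h \<in> carrier ((GL R M)\<lparr>carrier := U\<rparr>)"
      "(\<lambda>e\<in>transversal_flags R M k f. act g e) e = (\<lambda>e\<in>transversal_flags R M k f. act h e) e"
    then show "g = h" by (intro U_simple[of g h e]) simp_all
  qed
qed

lemma bij_betw_act:
  assumes e: "e \<in> transversal_flags R M k f"
  shows "bij_betw (\<lambda>g. act g e) U (transversal_flags R M k f)"
  unfolding bij_betw_def
proof
  show "inj_on (\<lambda>g. act g e) U" by (rule inj_onI) (rule U_simple[OF _ _ e])
  show "(\<lambda>g. act g e) ` U = transversal_flags R M k f"
  proof (intro equalityI subsetI)
    fix e' assume "e' \<in> transversal_flags R M k f"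
    then obtain g where "g \<in> U" "act g e = e'" using U_transitive[OF e] by blast
    then show "e' \<in> (\<lambda>g. act g e) ` U" by blast
  qed (use act_U_closed[OF _ e] in blast)
qed

end

section \<open>The exponential\<close>

text \<open>The map n |-> n 1 from the naturals to the ring is multiplicative; thus the image of a
  factorial is a product of images of its factors.\<close>

lemma (in cring) add_pow_one_mult: "([(m :: nat)] \<cdot>\<^bsub>R\<^esub> \<one>) \<otimes> ([(n :: nat)] \<cdot>\<^bsub>R\<^esub> \<one>) = [(m * n)] \<cdot>\<^bsub>R\<^esub> \<one>"
proof -
  have "([m] \<cdot>\<^bsub>R\<^esub> \<one>) \<otimes> ([n] \<cdot>\<^bsub>R\<^esub> \<one>) = [m] \<cdot>\<^bsub>R\<^esub> ([n] \<cdot>\<^bsub>R\<^esub> \<one>)"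
    by (simp add: add_pow_ldistr)
  also have "\<dots> = [(m * n)] \<cdot>\<^bsub>R\<^esub> \<one>"
    by (simp add: add.nat_pow_pow mult.commute)
  finally show ?thesis .
qed

lemma (in cring) fact_Units:
  assumes "\<forall>n\<in>{2..k - 1}. [(n :: nat)] \<cdot>\<^bsub>R\<^esub> \<one> \<in> Units R"
  shows "i < k \<Longrightarrow> [(fact i :: nat)] \<cdot>\<^bsub>R\<^esub> \<one> \<in> Units R"
proof (induction i)
  case (Suc i)
  have "[(Suc i)] \<cdot>\<^bsub>R\<^esub> \<one> \<in> Units R"
  \<comment> \<open>The factor 1 lies outside the assumed range but is a unit anyway.\<close>
  proof (cases "i = 0")
    case False
    then have "Suc i \<in> {2..k - 1}" using Suc.prems by auto
    then show ?thesis using assms by blast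
  qed simp
  then have "([(Suc i)] \<cdot>\<^bsub>R\<^esub> \<one>) \<otimes> ([(fact i :: nat)] \<cdot>\<^bsub>R\<^esub> \<one>) \<in> Units R"
    using Suc by (intro Units_m_closed) auto
  then show ?case by (simp only: add_pow_one_mult fact_Suc of_nat_id)
qed simp

context flagged_module
begin

abbreviation exp_coeff :: "nat \<Rightarrow> 'a"
  where "exp_coeff i \<equiv> inv\<^bsub>R\<^esub> ([(fact i :: nat)] \<cdot>\<^bsub>R\<^esub> \<one>\<^bsub>R\<^esub>)"

lemma submodule_u: "submodule u R (End_module R M)"
proof -
  interpret End: module R "End_module R M" by (rule module_End_module)
  have rst: "(\<lambda>v\<in>carrier M. X v) \<in> u" if "X \<in> linear_maps R M M" "lowers 1 X" for X
    unfolding u_iff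
  proof (intro conjI)
    show "(\<lambda>v\<in>carrier M. X v) \<in> linear_maps R M M"
      by (rule linear_maps_cong[OF that(1) module_axioms]) simp
    show "lowers 1 (\<lambda>v\<in>carrier M. X v)" by (rule lowers_cong[OF that(2)]) simp
  qed simp
  have add: "X \<oplus>\<^bsub>End_module R M\<^esub> Y \<in> u" if "X \<in> u" "Y \<in> u" for X Y
    using rst[OF linear_maps_add[of X Y] lowers_add[of 1 X Y]] that by (simp add: End_module_def u_iff)
  have smult: "r \<odot>\<^bsub>End_module R M\<^esub> X \<in> u" if "r \<in> carrier R" "X \<in> u" for r X
    using rst[OF linear_maps_smult[of r X] lowers_smult[of r 1 X]] that by (simp add: End_module_def u_iff)
  have sub: "u \<subseteq> carrier (End_module R M)" by (auto simp: u_alg_def)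
  show ?thesis
  proof (rule End.submoduleI[OF sub])
    show "\<zero>\<^bsub>End_module R M\<^esub> \<in> u"
      using rst[OF linear_maps_zero lowers_zero] by (simp add: End_module_def)
    fix X assume X: "X \<in> u"
    then have "\<ominus>\<^bsub>End_module R M\<^esub> X = (\<ominus> \<one>) \<odot>\<^bsub>End_module R M\<^esub> X"
      using sub by (auto simp: End.smult_l_minus)
    then show "\<ominus>\<^bsub>End_module R M\<^esub> X \<in> u" using smult[OF _ X] by simp
  qed (use add smult in auto)
qed

lemma module_u: "module R (u_module R M k f)"
  by (rule submodule.submodule_is_module[OF submodule_u module_End_module])

lemma nil_exp_extensional: "nil_exp R M k X \<in> extensional (carrier M)"
  by (simp add: nil_exp_def)

text \<open>The coefficients of degree 0 and 1 are inverses of 0! = 1! = 1, and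
  \<open>2 \<le> k\<close> ensures that both terms occur in the truncated sum.\<close>

lemma nil_exp_eq:
  assumes k: "2 \<le> k" and c: "\<And>n. n < k \<Longrightarrow> exp_coeff n \<in> carrier R"
    and X: "X \<in> linear_maps R M M" and v: "v \<in> carrier M"
  shows "nil_exp R M k X v = v \<oplus>\<^bsub>M\<^esub> (X v \<oplus>\<^bsub>M\<^esub> tail exp_coeff X v)"
proof -
  have set: "{..<k} = insert 0 (insert 1 {2..<k})" using k by auto
  have "(X ^^ n) v \<in> carrier M" for n
    using linear_mapsD(1)[OF linear_maps_funpow[OF X] v] .
  then have car: "exp_coeff n \<odot>\<^bsub>M\<^esub> (X ^^ n) v \<in> carrier M" if "n < k" for n
    using c[OF that] by simp
  have "nil_exp R M k X v = (\<Oplus>\<^bsub>M\<^esub>n\<in>insert 0 (insert 1 {2..<k}). exp_coeff n \<odot>\<^bsub>M\<^esub> (X ^^ n) v)"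
    using v by (simp add: nil_exp_def set)
  also have "\<dots> = exp_coeff 0 \<odot>\<^bsub>M\<^esub> (X ^^ 0) v \<oplus>\<^bsub>M\<^esub>
      (exp_coeff 1 \<odot>\<^bsub>M\<^esub> (X ^^ 1) v \<oplus>\<^bsub>M\<^esub> tail exp_coeff X v)"
    unfolding tail_def using car car[of 0] car[of 1] k
    by (subst M.finsum_insert; (subst M.finsum_insert)?) (auto simp: Pi_def)
  finally show ?thesis using v linear_mapsD(1)[OF X v] by simp
qed

context
  assumes k: "2 \<le> k"
    and Units: "\<forall>n\<in>{2..k - 1}. [n] \<cdot>\<^bsub>R\<^esub> \<one>\<^bsub>R\<^esub> \<in> Units R"
begin

lemma exp_coeff_closed: "n < k \<Longrightarrow> exp_coeff n \<in> carrier R"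
  using R.fact_Units[OF Units] by simp

lemmas nil_exp_tail = nil_exp_eq[OF k exp_coeff_closed]

text \<open>exp(X) = g amounts to X + T(X) = g - 1, where g - 1 lowers by 1 exactly for unipotent g.
  Uniqueness of the solution gives injectivity, its existence surjectivity.\<close>

lemma bij_betw_nil_exp: "bij_betw (nil_exp R M k) u U"
proof -
  let ?t = "tail exp_coeff"
  have t: "?t X \<in> linear_maps R M M" "lowers 1 (?t X)" if "X \<in> u" for X
    using linear_maps_tail[OF exp_coeff_closed] lowers_tail[OF exp_coeff_closed] that
    by (auto simp: u_iff)
  note car = linear_mapsD(1)[OF t(1)]
  have ucar: "X v \<in> carrier M" if "X \<in> u" "v \<in> carrier M" for X v
    using that linear_mapsD(1)[of X R M M] by (simp add: u_iff)
  have "inj_on (nil_exp R M k) u"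
  proof (rule inj_onI)
    fix X Y assume X: "X \<in> u" and Y: "Y \<in> u" and eq: "nil_exp R M k X = nil_exp R M k Y"
    have "X v = Y v" if v: "v \<in> carrier M" for v
    proof (rule tail_equation_unique[where c = exp_coeff and X = X and Y = Y and v = v])
      fix v assume v: "v \<in> carrier M"
      have "nil_exp R M k X v = nil_exp R M k Y v" using eq by simp
      then show "X v \<oplus>\<^bsub>M\<^esub> ?t X v = Y v \<oplus>\<^bsub>M\<^esub> ?t Y v"
        using X Y v car[OF X v] car[OF Y v] ucar[OF X v] ucar[OF Y v]
        by (simp add: nil_exp_tail u_iff)
    qed (use X Y v exp_coeff_closed in \<open>auto simp: u_iff\<close>)
    then show "X = Y"
      using X Y by (intro extensionalityI[of _ "carrier M"]) (auto simp: u_iff)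
  qed
  moreover have "nil_exp R M k ` u \<subseteq> U"
  proof
    fix g assume "g \<in> nil_exp R M k ` u"
    then obtain X where X: "X \<in> u" "g = nil_exp R M k X" by auto
    have Xl: "X \<in> linear_maps R M M" "lowers 1 X" using X by (auto simp: u_iff)
    let ?g = "\<lambda>v. v \<oplus>\<^bsub>M\<^esub> (X v \<oplus>\<^bsub>M\<^esub> ?t X v)"
    have "(\<lambda>v\<in>carrier M. ?g v) \<in> U"
    proof (rule U_I)
      show "?g \<in> linear_maps R M M"
        by (intro linear_maps_add linear_maps_id Xl t(1) X(1))
      show "lowers 1 (\<lambda>v. ?g v \<ominus>\<^bsub>M\<^esub> v)"
        by (rule lowers_cong[OF lowers_add[OF Xl(2) t(2)[OF X(1)]]])
          (simp add: add_minus_cancel car[OF X(1)] ucar[OF X(1)])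
    qed
    also have "(\<lambda>v\<in>carrier M. ?g v) = g"
      unfolding X(2)
      by (rule extensionalityI[of _ "carrier M"]) (simp_all add: nil_exp_tail[OF _ Xl(1)] nil_exp_extensional)
    finally show "g \<in> U" .
  qed
  moreover have "U \<subseteq> nil_exp R M k ` u"
  proof
    fix g assume g: "g \<in> U"
    have gc: "g v \<in> carrier M" if "v \<in> carrier M" for v
      using linear_mapsD(1)[OF U_linear[OF g] that] .
    obtain Y where Y: "Y \<in> linear_maps R M M" "lowers 1 Y"
      "\<And>v. v \<in> carrier M \<Longrightarrow> Y v \<oplus>\<^bsub>M\<^esub> ?t Y v = g v \<ominus>\<^bsub>M\<^esub> v"
      using tail_equation_solvable[where c = exp_coeff, OF exp_coeff_closed
          linear_maps_minus[OF U_linear[OF g] linear_maps_id] U_unipotent[OF g]] by blast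
    \<comment> \<open>Elements of \<open>u\<close> are extensional, so the solution is cut down to
      the carrier, where its powers stay the same.\<close>
    let ?X = "\<lambda>v\<in>carrier M. Y v"
    have Xl: "?X \<in> linear_maps R M M"
      by (rule linear_maps_cong[OF Y(1) module_axioms]) simp
    have X: "?X \<in> u"
      unfolding u_iff using Xl lowers_cong[OF Y(2), of ?X] by simp
    have pow: "(?X ^^ n) v = (Y ^^ n) v" if "v \<in> carrier M" for n v
      using linear_mapsD(1)[OF linear_maps_funpow[OF Y(1)] that] by (induction n) simp_all
    have "g = nil_exp R M k ?X"
    proof (rule extensionalityI[of _ "carrier M"])
      fix v assume v: "v \<in> carrier M"
      have "nil_exp R M k ?X v = v \<oplus>\<^bsub>M\<^esub> (?X v \<oplus>\<^bsub>M\<^esub> ?t ?X v)"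
        by (rule nil_exp_tail[OF _ Xl v])
      also have "\<dots> = v \<oplus>\<^bsub>M\<^esub> (g v \<ominus>\<^bsub>M\<^esub> v)"
        using Y(3)[OF v] pow[OF v] v by (simp add: tail_def)
      finally show "g v = nil_exp R M k ?X v" using v gc by (simp add: add_minus_cancel)
    qed (use g in \<open>auto simp: U_iff nil_exp_extensional\<close>)
    with X show "g \<in> nil_exp R M k ` u" by blast
  qed
  ultimately show ?thesis by (simp add: bij_betw_def subset_antisym)
qed

lemma bij_betw_exp_act:
  assumes e: "e \<in> transversal_flags R M k f"
  shows "bij_betw (exp_act R M k e) u (transversal_flags R M k f)"
proof -
  have "exp_act R M k e = (\<lambda>g. act g e) \<circ> nil_exp R M k"
    by (auto simp: exp_act_def)
  with bij_betw_trans[OF bij_betw_nil_exp bij_betw_act[OF e]] show ?thesis by simp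
qed

section \<open>The module structure on the transversal flags\<close>

lemma exp_act_inj:
  assumes e: "e \<in> transversal_flags R M k f"
  shows "inj_on (exp_act R M k e) (carrier (u_module R M k f))"
  using bij_betw_exp_act[OF e] by (simp add: bij_betw_def)

lemma flag_module_carrier:
  assumes e: "e \<in> transversal_flags R M k f"
  shows "carrier (flag_module R M k f e) = transversal_flags R M k f"
  using bij_betw_exp_act[OF e] by (simp add: flag_module_def transport_def Let_def bij_betw_def)

lemma flag_module_module:
  assumes e: "e \<in> transversal_flags R M k f"
  shows "module R (flag_module R M k f e)"
  unfolding flag_module_def by (rule module_transport[OF module_u exp_act_inj[OF e]])

lemma exp_act_linear_iso:
  assumes e: "e \<in> transversal_flags R M k f"
  shows "exp_act R M k e \<in> linear_isos R (u_module R M k f) (flag_module R M k f e)"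
  unfolding flag_module_def by (rule transport_linear_iso[OF module_u exp_act_inj[OF e]])

lemma flag_module_zero:
  assumes e: "e \<in> transversal_flags R M k f"
  shows "\<zero>\<^bsub>flag_module R M k f e\<^esub> = e"
proof -
  let ?z = "\<lambda>v\<in>carrier M. \<zero>\<^bsub>M\<^esub>"
  have zl: "?z \<in> linear_maps R M M"
    by (rule linear_maps_cong[OF linear_maps_zero module_axioms]) simp
  have pow: "(?z ^^ n) v = \<zero>\<^bsub>M\<^esub>" if "n \<ge> 2" "v \<in> carrier M" for n v
  proof -
    have "(?z ^^ Suc m) v = \<zero>\<^bsub>M\<^esub>" for m
      using that(2) by (induction m) simp_all
    with that(1) show ?thesis by (cases n) auto
  qed
  have "\<zero>\<^bsub>flag_module R M k f e\<^esub> = act (nil_exp R M k ?z) e"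
    by (simp add: flag_module_def transport_def Let_def exp_act_def End_module_def)
  also have "\<dots> = act (\<lambda>v\<in>carrier M. v) e"
  proof (rule act_cong[OF transversal_flagsD(1)[OF e]])
    fix v assume v: "v \<in> carrier M"
    have "tail exp_coeff ?z v = (\<Oplus>\<^bsub>M\<^esub>n\<in>{2..<k}. \<zero>\<^bsub>M\<^esub>)"
      unfolding tail_def using v pow exp_coeff_closed by (intro M.finsum_cong') auto
    then show "nil_exp R M k ?z v = (\<lambda>v\<in>carrier M. v) v"
      using nil_exp_tail[OF _ zl v] v by simp
  qed
  also have "\<dots> = e" by (rule act_id[OF transversal_flagsD(1)[OF e]])
  finally show ?thesis .
qed

lemma exp_act_add:
  assumes "k = 2" and X: "X \<in> u" and Z: "Z \<in> u" and e: "e \<in> transversal_flags R M k f"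
  shows "exp_act R M k (exp_act R M k e Z) X = exp_act R M k e (X \<oplus>\<^bsub>u_module R M k f\<^esub> Z)"
proof -
  have nil: "nil_exp R M k Y v = v \<oplus>\<^bsub>M\<^esub> Y v" if "Y \<in> linear_maps R M M" "v \<in> carrier M" for Y v
  proof -
    have "{2..<k} = {}" using \<open>k = 2\<close> by simp
    then have "tail exp_coeff Y v = \<zero>\<^bsub>M\<^esub>" by (simp add: tail_def)
    then show ?thesis
      using nil_exp_tail[OF _ that] linear_mapsD(1)[OF that] by simp
  qed
  have l: "X \<in> linear_maps R M M" "Z \<in> linear_maps R M M" "lowers 1 X" "lowers 1 Z"
    using X Z by (auto simp: u_iff)
  note car = linear_mapsD(1)[OF l(1)] linear_mapsD(1)[OF l(2)]
  let ?S = "X \<oplus>\<^bsub>u_module R M k f\<^esub> Z"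
  have S: "?S = (\<lambda>v\<in>carrier M. X v \<oplus>\<^bsub>M\<^esub> Z v)" by (simp add: End_module_def)
  have Sl: "?S \<in> linear_maps R M M"
    unfolding S by (rule linear_maps_cong[OF linear_maps_add[OF l(1,2)] module_axioms]) simp
  \<comment> \<open>The composite lowers by 2, the whole length of the filtration.\<close>
  have XZ: "X (Z v) = \<zero>\<^bsub>M\<^esub>" if "v \<in> carrier M" for v
    using lowers_eq_zero[OF lowers_comp[OF l(3,4)] _ that] \<open>k = 2\<close> by simp
  have "exp_act R M k e ?S = act (compose (carrier M) (nil_exp R M k X) (nil_exp R M k Z)) e"
    unfolding exp_act_def
  proof (rule act_cong[OF transversal_flagsD(1)[OF e]])
    fix v assume v: "v \<in> carrier M"
    have "compose (carrier M) (nil_exp R M k X) (nil_exp R M k Z) v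
        = (v \<oplus>\<^bsub>M\<^esub> Z v) \<oplus>\<^bsub>M\<^esub> X (v \<oplus>\<^bsub>M\<^esub> Z v)"
      using v car by (simp add: compose_eq nil[OF l(1)] nil[OF l(2)])
    also have "\<dots> = v \<oplus>\<^bsub>M\<^esub> (X v \<oplus>\<^bsub>M\<^esub> Z v)"
      using v car by (simp add: linear_mapsD(2)[OF l(1)] XZ M.a_ac)
    also have "\<dots> = nil_exp R M k ?S v"
      using nil[OF Sl v] v unfolding S by simp
    finally show "nil_exp R M k ?S v
      = compose (carrier M) (nil_exp R M k X) (nil_exp R M k Z) v" by simp
  qed
  also have "\<dots> = act (nil_exp R M k X) (act (nil_exp R M k Z) e)"
    by (rule act_compose[OF transversal_flagsD(1)[OF e]])
  finally show ?thesis by (simp add: exp_act_def)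
qed

lemma flag_module_affine:
  assumes "k = 2" and e: "e \<in> transversal_flags R M k f" and e': "e' \<in> transversal_flags R M k f"
  shows "same_affine_structure R (flag_module R M k f e) (flag_module R M k f e')"
proof -
  \<comment> \<open>\<open>exp_act\<close> reaches every transversal flag, hence also the second
    base point; \<open>Z\<close> is its coordinate seen from \<open>e\<close>.\<close>
  obtain Z where Z: "Z \<in> u" "e' = exp_act R M k e Z"
    using bij_betw_exp_act[OF e] e' by (auto simp: bij_betw_def)
  show ?thesis
    unfolding flag_module_def
  proof (rule same_affine_structure_transport[OF module_u exp_act_inj[OF e]])
    show "Z \<in> carrier (u_module R M k f)" using Z by simp
    show "exp_act R M k e' X = exp_act R M k e (X \<oplus>\<^bsub>u_module R M k f\<^esub> Z)"
      if "X \<in> carrier (u_module R M k f)" for X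
      unfolding Z(2) using exp_act_add[OF assms(1) _ Z(1) e] that by simp
  qed
qed

end

end


section \<open>Geometries of flags\<close>

context module
begin

lemma complemented_flagD:
  assumes "f \<in> complemented_flags R M k"
  shows "flag R M k f" "flagged_module R M k f"
  using assms
  by (auto simp: complemented_flags_def intro!: flagged_module.intro flagged_module_axioms.intro
      module_axioms)

text \<open>A flag transversal to \<open>f\<close> is itself complemented, with \<open>f\<close> as
  witness. Hence the points transversal to \<open>f\<close> in the geometry are all of its
  transversal flags, whichever way the relation is read.\<close>

lemma complemented_transversal_iff:
  assumes "f \<in> complemented_flags R M k"
  shows "e \<in> complemented_flags R M k \<and> transversal M k f e \<longleftrightarrow> e \<in> transversal_flags R M k f"
    and "e \<in> complemented_flags R M k \<and> transversal M k e f \<longleftrightarrow> e \<in> transversal_flags R M k f"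
  using assms transversal_sym[of k f e] transversal_sym[of k e f]
  by (auto simp: complemented_flags_def transversal_flags_def)

lemma pair_geometry_flags:
  "pair_geometry (complemented_flags R M k) (complemented_flags R M k) (transversal M k)"
proof
  have ex: "\<exists>e\<in>complemented_flags R M k. transversal M k f e \<and> transversal M k e f"
    if "f \<in> complemented_flags R M k" for f
    using that transversal_sym[of k f] unfolding complemented_flags_def by blast
  show "\<exists>e\<in>complemented_flags R M k. transversal M k f e" if "f \<in> complemented_flags R M k" for f
    using ex[OF that] by blast
  show "\<exists>e\<in>complemented_flags R M k. transversal M k e f" if "f \<in> complemented_flags R M k" for f
    using ex[OF that] by blast
qed

context
  fixes k :: nat
  assumes k: "2 \<le> k"
    and Units: "\<forall>n\<in>{2..k - 1}. [n] \<cdot>\<^bsub>R\<^esub> \<one>\<^bsub>R\<^esub> \<in> Units R"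
begin

text \<open>Transversality is symmetric, so one family of modules serves both sides: its first flag
  determines the transversal set, its second is the zero vector.\<close>

lemma linear_pair_geometry_flags:
  "linear_pair_geometry R (complemented_flags R M k) (complemented_flags R M k)
    (transversal M k) (flag_module R M k) (flag_module R M k)"
proof (intro linear_pair_geometry.intro R.is_cring pair_geometry_flags
    linear_pair_geometry_axioms.intro)
  fix e f assume ef: "e \<in> complemented_flags R M k" "f \<in> complemented_flags R M k" "transversal M k e f"
  interpret E: flagged_module R M k e by (rule complemented_flagD[OF ef(1)])
  interpret F: flagged_module R M k f by (rule complemented_flagD[OF ef(2)])
  have mem: "f \<in> transversal_flags R M k e" "e \<in> transversal_flags R M k f"
    using complemented_transversal_iff ef by blast+
  show "module R (flag_module R M k f e)" "module R (flag_module R M k e f)"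
    using F.flag_module_module[OF k Units mem(2)] E.flag_module_module[OF k Units mem(1)] by auto
  show "carrier (flag_module R M k f e) = {y \<in> complemented_flags R M k. transversal M k y f}"
    using F.flag_module_carrier[OF k Units mem(2)] complemented_transversal_iff(2)[OF ef(2)] by auto
  show "carrier (flag_module R M k e f) = {y \<in> complemented_flags R M k. transversal M k e y}"
    using E.flag_module_carrier[OF k Units mem(1)] complemented_transversal_iff(1)[OF ef(1)] by auto
  show "\<zero>\<^bsub>flag_module R M k f e\<^esub> = e" "\<zero>\<^bsub>flag_module R M k e f\<^esub> = f"
    using F.flag_module_zero[OF k Units mem(2)] E.flag_module_zero[OF k Units mem(1)] by auto
qed

lemma affine_pair_geometry_flags:
  assumes "k = 2"
  shows "affine_pair_geometry R (complemented_flags R M k) (complemented_flags R M k)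
    (transversal M k) (flag_module R M k) (flag_module R M k)"
proof (intro affine_pair_geometry.intro linear_pair_geometry_flags affine_pair_geometry_axioms.intro)
  fix x y a assume "x \<in> complemented_flags R M k" "y \<in> complemented_flags R M k"
    "a \<in> complemented_flags R M k" "transversal M k x a" "transversal M k y a"
  then show "same_affine_structure R (flag_module R M k a x) (flag_module R M k a y)"
    using flagged_module.flag_module_affine[OF complemented_flagD(2) k Units assms]
      complemented_transversal_iff(2) by blast
next
  fix x a b assume "x \<in> complemented_flags R M k" "a \<in> complemented_flags R M k"
    "b \<in> complemented_flags R M k" "transversal M k x a" "transversal M k x b"
  then show "same_affine_structure R (flag_module R M k x a) (flag_module R M k x b)"
    using flagged_module.flag_module_affine[OF complemented_flagD(2) k Units assms]
      complemented_transversal_iff(1) by blast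
qed

end

end

theorem theorem3p5:
  fixes R :: "('r, 'x) ring_scheme" and M :: "('r, 'm, 'y) module_scheme" and k :: nat
  assumes "module R M"
    and "[(2::nat)] \<cdot>\<^bsub>R\<^esub> \<one>\<^bsub>R\<^esub> \<in> Units R"
    and "k \<ge> 2"
  shows
    "(\<forall>f \<in> complemented_flags R M k.
        subgroup (U_grp R M k f) (GL R M) \<and>
        simply_transitive_action ((GL R M)\<lparr>carrier := U_grp R M k f\<rparr>)
          (transversal_flags R M k f) (\<lambda>g. (\<lambda>e \<in> transversal_flags R M k f. act g e))) \<and>
     ((\<forall>n \<in> {2..k - 1}. [n] \<cdot>\<^bsub>R\<^esub> \<one>\<^bsub>R\<^esub> \<in> Units R) \<longrightarrow>
        (\<forall>f \<in> complemented_flags R M k. \<forall>e \<in> complemented_flags R M k. transversal M k f e \<longrightarrow>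
           bij_betw (exp_act R M k e) (u_alg R M k f) (transversal_flags R M k f) \<and>
           exp_act R M k e \<in> linear_isos R (u_module R M k f) (flag_module R M k f e)) \<and>
        linear_pair_geometry R (complemented_flags R M k) (complemented_flags R M k)
          (transversal M k) (flag_module R M k) (flag_module R M k)) \<and>
     (k = 2 \<longrightarrow>
        affine_pair_geometry R (complemented_flags R M k) (complemented_flags R M k)
          (transversal M k) (flag_module R M k) (flag_module R M k))"
proof (intro conjI impI ballI)
  interpret module R M by fact
  fix f assume f: "f \<in> complemented_flags R M k"
  then interpret F: flagged_module R M k f by (rule complemented_flagD)
  show "subgroup (U_grp R M k f) (GL R M)" by (rule F.subgroup_U)
  show "simply_transitive_action ((GL R M)\<lparr>carrier := U_grp R M k f\<rparr>)
      (transversal_flags R M k f) (\<lambda>g. (\<lambda>e \<in> transversal_flags R M k f. act g e))"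
    by (rule F.simply_transitive_U)
  assume Units: "\<forall>n \<in> {2..k - 1}. [n] \<cdot>\<^bsub>R\<^esub> \<one>\<^bsub>R\<^esub> \<in> Units R"
  fix e assume "e \<in> complemented_flags R M k" "transversal M k f e"
  then have e: "e \<in> transversal_flags R M k f"
    using complemented_transversal_iff(1)[OF f] by blast
  show "bij_betw (exp_act R M k e) (u_alg R M k f) (transversal_flags R M k f)"
    by (rule F.bij_betw_exp_act[OF assms(3) Units e])
  show "exp_act R M k e \<in> linear_isos R (u_module R M k f) (flag_module R M k f e)"
    by (rule F.exp_act_linear_iso[OF assms(3) Units e])
next
  interpret module R M by fact
  assume "\<forall>n \<in> {2..k - 1}. [n] \<cdot>\<^bsub>R\<^esub> \<one>\<^bsub>R\<^esub> \<in> Units R"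
  then show "linear_pair_geometry R (complemented_flags R M k) (complemented_flags R M k)
      (transversal M k) (flag_module R M k) (flag_module R M k)"
    by (rule linear_pair_geometry_flags[OF assms(3)])
next
  interpret module R M by fact
  assume "k = 2"
  then show "affine_pair_geometry R (complemented_flags R M k) (complemented_flags R M k)
      (transversal M k) (flag_module R M k) (flag_module R M k)"
    \<comment> \<open>For \<open>k = 2\<close> the range from 2 to \<open>k - 1\<close> is empty,
      and the invertibility condition holds vacuously.\<close>
    by (intro affine_pair_geometry_flags assms(3)) auto
qed

end
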